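(* Let $\chi$ be a non-constant inner function on $\mathbb{C}_+$ and let $\phi:\mathbb{C}_+\to\mathbb{C}_+$ be an analytic function such that $\sup_{z\in\mathbb{C}_+}|\chi(\phi(z))|<1$. If the composition operator $C_\phi: H(\chi)\to H^2(\mathbb{C}_+)$, $C_\phi f=f\circ\phi$, is bounded, then it is not compact.
   Context: $\mathbb{C}_+$ is the open upper half-plane and $H^2(\mathbb{C}_+)$ is the Hardy Hilbert space on $\mathbb{C}_+$, with norm given by the $L^2(\mathbb{R})$ norm of boundary values. An analytic function $\chi$ on $\mathbb{C}_+$ is inner if $|\chi(z)|\le 1$ for all $z\in\mathbb{C}_+$ and $|\chi(x)|=1$ for a.e. $x\in\mathbb{R}$ (boundary values). The model space associated with $\chi$ is $H(\chi):=H^2(\mathbb{C}_+)\ominus\chi H^2(\mathbb{C}_+)$, the orthogonal complement of $\chi H^2(\mathbb{C}_+)$ in $H^2(\mathbb{C}_+)$, with the inherited norm. Saying that $C_\phi: H(\chi)\to H^2(\mathbb{C}_+)$ is bounded means that $f\circ\phi\in H^2(\mathbb{C}_+)$ for all $f\in H(\chi)$ and $\|f\circ\phi\|\le M\|f\|$ for some constant $M$. *)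

theory Defs
  imports "HOL-Complex_Analysis.Complex_Analysis"
begin

definition upper_half_plane :: "complex set" (\<open>\<complex>\<^sub>+\<close>) where
  "\<complex>\<^sub>+ = {z. 0 < Im z}"

text \<open>
  Functions on the upper half-plane are represented by total functions; every notion below depends
  only on their values on \<open>\<complex>\<^sub>+\<close>.  Elements of the Hardy space \<open>H\<^sup>2\<close> are the holomorphic functions
  whose \<open>L\<^sup>2\<close> norms along horizontal lines are uniformly bounded.
\<close>

definition hardy2 :: "(complex \<Rightarrow> complex) set" where
  "hardy2 = {f. f holomorphic_on \<complex>\<^sub>+ \<and>
     (SUP y\<in>{0<..}. \<integral>\<^sup>+x. ennreal ((cmod (f (Complex x y)))\<^sup>2) \<partial>lborel) < \<infinity>}"

text \<open>
  Boundary values are vertical limits.  By Fatou's theorem they exist at almost every real point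
  for functions in \<open>H\<^sup>2\<close> and for bounded holomorphic functions; \<open>Lim\<close> takes an unspecified
  value where the limit does not exist.
\<close>

definition bdry :: "(complex \<Rightarrow> complex) \<Rightarrow> real \<Rightarrow> complex" where
  "bdry f x = Lim (at_right 0) (\<lambda>y. f (Complex x y))"

definition hardy2_inner :: "(complex \<Rightarrow> complex) \<Rightarrow> (complex \<Rightarrow> complex) \<Rightarrow> complex" where
  "hardy2_inner f g = (\<integral>x. bdry f x * cnj (bdry g x) \<partial>lborel)"

definition hardy2_norm :: "(complex \<Rightarrow> complex) \<Rightarrow> real" where
  "hardy2_norm f = sqrt (\<integral>x. (cmod (bdry f x))\<^sup>2 \<partial>lborel)"

definition inner_function :: "(complex \<Rightarrow> complex) \<Rightarrow> bool" where
  "inner_function \<Theta> \<longleftrightarrow>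
     \<Theta> holomorphic_on \<complex>\<^sub>+ \<and> (\<forall>z\<in>\<complex>\<^sub>+. cmod (\<Theta> z) \<le> 1) \<and>
     (AE x in lborel. \<exists>l. ((\<lambda>y. \<Theta> (Complex x y)) \<longlongrightarrow> l) (at_right 0) \<and> cmod l = 1)"

definition model_space :: "(complex \<Rightarrow> complex) \<Rightarrow> (complex \<Rightarrow> complex) set" where
  "model_space \<Theta> = {f \<in> hardy2. \<forall>g\<in>hardy2. hardy2_inner f (\<lambda>z. \<Theta> z * g z) = 0}"

definition comp_op :: "(complex \<Rightarrow> complex) \<Rightarrow> (complex \<Rightarrow> complex) \<Rightarrow> complex \<Rightarrow> complex" where
  "comp_op \<phi> f = f \<circ> \<phi>"

text \<open>
  The next two predicates concern a linear operator \<open>T\<close> from a subspace \<open>S\<close> of \<open>H\<^sup>2\<close>, with the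
  inherited norm, into \<open>H\<^sup>2\<close>.
\<close>

definition bounded_into_hardy2 ::
    "(complex \<Rightarrow> complex) set \<Rightarrow> ((complex \<Rightarrow> complex) \<Rightarrow> complex \<Rightarrow> complex) \<Rightarrow> bool" where
  "bounded_into_hardy2 S T \<longleftrightarrow>
     (\<forall>f\<in>S. T f \<in> hardy2) \<and> (\<exists>M. \<forall>f\<in>S. hardy2_norm (T f) \<le> M * hardy2_norm f)"

text \<open>Compactness: images of bounded sequences have norm-convergent subsequences.\<close>

definition compact_into_hardy2 ::
    "(complex \<Rightarrow> complex) set \<Rightarrow> ((complex \<Rightarrow> complex) \<Rightarrow> complex \<Rightarrow> complex) \<Rightarrow> bool" where
  "compact_into_hardy2 S T \<longleftrightarrow>
     (\<forall>f :: nat \<Rightarrow> complex \<Rightarrow> complex.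
        (\<forall>n. f n \<in> S) \<and> (\<exists>B. \<forall>n. hardy2_norm (f n) \<le> B) \<longrightarrow>
        (\<exists>g\<in>hardy2. \<exists>r :: nat \<Rightarrow> nat. strict_mono r \<and>
           (\<lambda>n. hardy2_norm (\<lambda>z. T (f (r n)) z - g z)) \<longlonglongrightarrow> 0))"

end

theory Submission
  imports Defs "HOL-Probability.Sinc_Integral"
begin

text \<open>
  Compactness is tested on multiples \<open>f\<^sub>n\<close> of the reproducing kernels of the model space at the points
  \<open>w\<^sub>n = \<phi>(\<i>(n + 1))\<close>, which climb the image of the imaginary axis.  Write \<open>\<delta> = 1 - s\<^sup>2\<close>, where \<open>s < 1\<close>
  bounds \<open>\<bar>\<Theta> \<circ> \<phi>\<bar>\<close>.  The function
  \<open>z \<mapsto> sqrt (Im w) (1 - cnj (\<Theta> w) \<Theta> z) / (z - cnj w)\<close> lies in the model space with norm at most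
  \<open>2 sqrt \<pi>\<close>, and its modulus at \<open>w\<close> is \<open>(1 - \<bar>\<Theta> w\<bar>\<^sup>2) / (2 sqrt (Im w))\<close>.  By the Schwarz-Pick lemma
  \<open>Im w\<^sub>n \<le> (n + 1) Im (\<phi> \<i>)\<close>, so \<open>\<bar>(f\<^sub>n \<circ> \<phi>)(\<i>y)\<bar> \<ge> c / sqrt y\<close> at \<open>y = n + 1\<close>, with \<open>c > 0\<close>
  determined by \<open>\<delta>\<close> and \<open>\<phi> \<i>\<close> alone.

  If the images \<open>f\<^sub>n \<circ> \<phi>\<close> had a subsequence converging in norm to some \<open>g\<close> in \<open>H\<^sup>2\<close>, the estimate
  \<open>sqrt (Im w) \<bar>h w\<bar> \<le> \<parallel>h\<parallel>\<close> for the differences \<open>h = f\<^sub>n \<circ> \<phi> - g\<close> would give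
  \<open>liminf sqrt y \<bar>g(\<i>y)\<bar> \<ge> c\<close> along the heights of that subsequence.  But \<open>sqrt y \<bar>g(\<i>y)\<bar> \<longlonglongrightarrow> 0\<close> as
  \<open>y \<longlonglongrightarrow> \<infinity>\<close> for every \<open>g\<close> in \<open>H\<^sup>2\<close>, a contradiction.  Lemmas \<open>model_kernel_in_model_space\<close>,
  \<open>model_kernel_norm_le\<close>, \<open>schwarz_pick_imaginary_axis\<close>, \<open>hardy2_point_evaluation\<close> and
  \<open>hardy2_decay_imaginary_axis\<close> carry this argument.

  Norm and inner product of \<open>H\<^sup>2\<close> are expressed through vertical boundary limits, so everything rests on
  boundary values (\<open>hardy2_bdry\<close>): for \<open>f\<close> in \<open>H\<^sup>2\<close> the limits exist almost everywhere, are square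
  integrable, and \<open>f\<close> is their Poisson integral.  Above a line \<open>Im z = \<eta> > 0\<close> the function \<open>f\<close> is bounded,
  and Cauchy's theorem gives the Poisson formula there.  Since convolution with the Poisson kernel is
  symmetric, the inner product of the slices of \<open>f\<close> at heights \<open>y\<close> and \<open>y'\<close> depends on \<open>y + y'\<close> only;
  expanding the square then shows that the slices form a Cauchy family in \<open>L\<^sup>2\<close> as \<open>y \<longlonglongrightarrow> 0\<close>.  Their limit
  represents \<open>f\<close> by a Poisson integral, and the Lebesgue differentiation theorem turns this into
  convergence almost everywhere.  The Cauchy formula on the boundary (\<open>hardy2_cauchy_formula\<close>) follows,
  and with it orthogonality, point evaluations and decay.
\<close>

section \<open>Square-integrable functions on the line\<close>

definition square_integrable :: "(real \<Rightarrow> complex) \<Rightarrow> bool" where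
  "square_integrable f \<longleftrightarrow>
     f \<in> borel_measurable lborel \<and> integrable lborel (\<lambda>x. (cmod (f x))\<^sup>2)"

definition norm_L2 :: "(real \<Rightarrow> complex) \<Rightarrow> real" where
  "norm_L2 f = sqrt (\<integral>x. (cmod (f x))\<^sup>2 \<partial>lborel)"

lemma square_integrableD:
  assumes "square_integrable f"
  shows "f \<in> borel_measurable lborel" "f \<in> borel_measurable borel" "integrable lborel (\<lambda>x. (cmod (f x))\<^sup>2)"
  using assms by (auto simp: square_integrable_def)

lemma norm_L2_nonneg: "0 \<le> norm_L2 f"
  by (simp add: norm_L2_def)

lemma norm_L2_power2: "(norm_L2 f)\<^sup>2 = (\<integral>x. (cmod (f x))\<^sup>2 \<partial>lborel)"
  by (simp add: norm_L2_def)

lemma square_integrable_nn_integral: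
  assumes "square_integrable f"
  shows "(\<integral>\<^sup>+x. ennreal ((cmod (f x))\<^sup>2) \<partial>lborel) = ennreal ((norm_L2 f)\<^sup>2)"
  unfolding norm_L2_power2
  by (rule nn_integral_eq_integral) (use square_integrableD[OF assms] in auto)

lemma square_integrableI_bounded:
  assumes "f \<in> borel_measurable lborel"
    and "(\<integral>\<^sup>+x. ennreal ((cmod (f x))\<^sup>2) \<partial>lborel) \<le> ennreal C" "0 \<le> C"
  shows "square_integrable f" "(norm_L2 f)\<^sup>2 \<le> C"
proof -
  have "integrable lborel (\<lambda>x. (cmod (f x))\<^sup>2)"
    using assms by (intro integrableI_bounded) (auto intro: order_le_less_trans[OF _ ennreal_less_top])
  then show *: "square_integrable f"
    using assms(1) by (simp add: square_integrable_def)
  show "(norm_L2 f)\<^sup>2 \<le> C"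
    using assms(2,3) unfolding square_integrable_nn_integral[OF *] by simp
qed

text \<open>
  The Cauchy-Schwarz inequality; the product is integrable because \<open>2 a b \<le> a\<^sup>2 + b\<^sup>2\<close>.
\<close>
lemma square_integrable_mult:
  assumes f: "square_integrable f" and g: "square_integrable g"
  shows "integrable lborel (\<lambda>x. f x * g x)"
    and "(\<integral>x. cmod (f x * g x) \<partial>lborel) \<le> norm_L2 f * norm_L2 g"
    and "cmod (\<integral>x. f x * g x \<partial>lborel) \<le> norm_L2 f * norm_L2 g"
proof -
  note [measurable] = square_integrableD(1)[OF f] square_integrableD(1)[OF g]
  have bound: "cmod (f x * g x) \<le> (cmod (f x))\<^sup>2 + (cmod (g x))\<^sup>2" for x
  proof -
    have "0 \<le> (cmod (f x) - cmod (g x))\<^sup>2" by simp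
    moreover have "0 \<le> cmod (f x) * cmod (g x)" by simp
    ultimately show ?thesis unfolding norm_mult power2_diff by linarith
  qed
  show i: "integrable lborel (\<lambda>x. f x * g x)"
    by (rule Bochner_Integration.integrable_bound[OF Bochner_Integration.integrable_add
          [OF square_integrableD(3)[OF f] square_integrableD(3)[OF g]]])
      (use bound in \<open>auto simp: abs_of_nonneg\<close>)
  have "(\<integral>\<^sup>+x. ennreal (cmod (f x)) * ennreal (cmod (g x)) \<partial>lborel)\<^sup>2
      \<le> (\<integral>\<^sup>+x. ennreal (cmod (f x)) ^ 2 \<partial>lborel) * (\<integral>\<^sup>+x. ennreal (cmod (g x)) ^ 2 \<partial>lborel)"
    by (rule Cauchy_Schwarz_nn_integral) auto
  also have "\<dots> = ennreal ((norm_L2 f)\<^sup>2) * ennreal ((norm_L2 g)\<^sup>2)"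
    by (simp add: ennreal_power square_integrable_nn_integral[OF f] square_integrable_nn_integral[OF g])
  also have "(\<integral>\<^sup>+x. ennreal (cmod (f x)) * ennreal (cmod (g x)) \<partial>lborel)
      = (\<integral>\<^sup>+x. ennreal (cmod (f x * g x)) \<partial>lborel)"
    by (simp add: norm_mult ennreal_mult)
  also have "\<dots> = ennreal (\<integral>x. cmod (f x * g x) \<partial>lborel)"
    by (rule nn_integral_eq_integral) (use i in auto)
  finally have "(\<integral>x. cmod (f x * g x) \<partial>lborel)\<^sup>2 \<le> (norm_L2 f * norm_L2 g)\<^sup>2"
    by (simp add: ennreal_power ennreal_mult[symmetric] power_mult_distrib)
  then show "(\<integral>x. cmod (f x * g x) \<partial>lborel) \<le> norm_L2 f * norm_L2 g"
    by (rule power2_le_imp_le) (simp add: norm_L2_nonneg)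
  then show "cmod (\<integral>x. f x * g x \<partial>lborel) \<le> norm_L2 f * norm_L2 g"
    using integral_norm_bound[of lborel "\<lambda>x. f x * g x"] by linarith
qed

lemma square_integrable_cmult:
  assumes f: "square_integrable f"
  shows "square_integrable (\<lambda>x. c * f x)" "norm_L2 (\<lambda>x. c * f x) = cmod c * norm_L2 f"
  using square_integrableD[OF f]
  by (auto simp: square_integrable_def norm_L2_def norm_mult power_mult_distrib real_sqrt_mult)

lemma square_integrable_cnj:
  assumes f: "square_integrable f"
  shows "square_integrable (\<lambda>x. cnj (f x))" "norm_L2 (\<lambda>x. cnj (f x)) = norm_L2 f"
  using square_integrableD[OF f] bounded_linear_cnj
  by (auto simp: square_integrable_def norm_L2_def
      intro!: borel_measurable_continuous_on[of cnj] continuous_intros)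

text \<open>
  The identity \<open>\<parallel>f - g\<parallel>\<^sup>2 = \<parallel>f\<parallel>\<^sup>2 + \<parallel>g\<parallel>\<^sup>2 - 2 Re \<langle>f, g\<rangle>\<close> is how the inner products of the slices of a Hardy
  space function will control their distances.
\<close>
lemma norm_L2_diff_expand:
  assumes f: "square_integrable f" and g: "square_integrable g"
  shows "square_integrable (\<lambda>x. f x - g x)"
    and "(norm_L2 (\<lambda>x. f x - g x))\<^sup>2
       = (norm_L2 f)\<^sup>2 + (norm_L2 g)\<^sup>2 - 2 * Re (\<integral>x. f x * cnj (g x) \<partial>lborel)"
proof -
  note [measurable] = square_integrableD(1)[OF f] square_integrableD(1)[OF g]
  note i = square_integrable_mult(1)[OF f square_integrable_cnj(1)[OF g]]
  have iR: "integrable lborel (\<lambda>x. Re (f x * cnj (g x)))"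
    using i by (rule integrable_Re)
  have eq: "(cmod (f x - g x))\<^sup>2 = (cmod (f x))\<^sup>2 + (cmod (g x))\<^sup>2 - 2 * Re (f x * cnj (g x))" for x
    unfolding cmod_power2 by (simp add: power2_eq_square algebra_simps)
  show "square_integrable (\<lambda>x. f x - g x)"
    unfolding square_integrable_def eq
    using square_integrableD[OF f] square_integrableD[OF g] iR
    by (auto simp del: times_complex.simps)
  show "(norm_L2 (\<lambda>x. f x - g x))\<^sup>2
       = (norm_L2 f)\<^sup>2 + (norm_L2 g)\<^sup>2 - 2 * Re (\<integral>x. f x * cnj (g x) \<partial>lborel)"
    unfolding norm_L2_power2 eq integral_Re[OF i, symmetric]
    using square_integrableD(3)[OF f] square_integrableD(3)[OF g] iR
    by (simp del: times_complex.simps)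
qed

lemma square_integrable_cong_AE:
  assumes f: "square_integrable f" and g: "g \<in> borel_measurable lborel" and ae: "AE x in lborel. f x = g x"
  shows "square_integrable g"
proof -
  note [measurable] = square_integrableD(1)[OF f] g
  have ae': "AE x in lborel. (cmod (f x))\<^sup>2 = (cmod (g x))\<^sup>2"
    using ae by eventually_elim simp
  show ?thesis
    unfolding square_integrable_def using square_integrableD(3)[OF f] ae' g
    by (subst integrable_cong_AE[where g="\<lambda>x. (cmod (f x))\<^sup>2"]) (auto elim: AE_mp)
qed

lemma square_integrable_dominated:
  fixes f g :: "real \<Rightarrow> complex"
  assumes g: "square_integrable g" and f: "f \<in> borel_measurable lborel"
    and le: "AE x in lborel. cmod (f x) \<le> C * cmod (g x)" and C: "0 \<le> C"
  shows "square_integrable f" "norm_L2 f \<le> C * norm_L2 g"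
proof -
  have "(\<integral>\<^sup>+x. ennreal ((cmod (f x))\<^sup>2) \<partial>lborel) \<le> (\<integral>\<^sup>+x. ennreal ((cmod (of_real C * g x))\<^sup>2) \<partial>lborel)"
    by (rule nn_integral_mono_AE, use le in eventually_elim)
      (use C in \<open>auto simp: norm_mult intro!: ennreal_leI power_mono\<close>)
  also have "\<dots> = ennreal ((C * norm_L2 g)\<^sup>2)"
    using square_integrable_nn_integral[OF square_integrable_cmult(1)[OF g]]
      square_integrable_cmult(2)[OF g, of "of_real C"] C by simp
  finally have *: "(\<integral>\<^sup>+x. ennreal ((cmod (f x))\<^sup>2) \<partial>lborel) \<le> ennreal ((C * norm_L2 g)\<^sup>2)" .
  show "square_integrable f" by (rule square_integrableI_bounded(1)[OF f *]) simp
  have "(norm_L2 f)\<^sup>2 \<le> (C * norm_L2 g)\<^sup>2" by (rule square_integrableI_bounded(2)[OF f *]) simp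
  then show "norm_L2 f \<le> C * norm_L2 g"
    by (rule power2_le_imp_le) (use C norm_L2_nonneg in auto)
qed

lemma norm_L2_diff_le:
  fixes f g :: "real \<Rightarrow> complex"
  assumes f: "square_integrable f" and g: "square_integrable g"
  shows "norm_L2 (\<lambda>x. f x - g x) \<le> norm_L2 f + norm_L2 g"
proof (rule power2_le_imp_le)
  have "cmod (\<integral>x. f x * cnj (g x) \<partial>lborel) \<le> norm_L2 f * norm_L2 g"
    using square_integrable_mult(3)[OF f square_integrable_cnj(1)[OF g]]
    by (simp only: square_integrable_cnj(2)[OF g])
  then have "- Re (\<integral>x. f x * cnj (g x) \<partial>lborel) \<le> norm_L2 f * norm_L2 g"
    using abs_Re_le_cmod[of "\<integral>x. f x * cnj (g x) \<partial>lborel"] by linarith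
  then show "(norm_L2 (\<lambda>x. f x - g x))\<^sup>2 \<le> (norm_L2 f + norm_L2 g)\<^sup>2"
    unfolding norm_L2_diff_expand(2)[OF f g] power2_sum by linarith
qed (simp add: norm_L2_nonneg)

text \<open>
  Cauchy-Schwarz against the indicator function of the interval, whose norm is \<open>sqrt (b - a)\<close>.
\<close>
lemma set_integral_norm_le_norm_L2:
  assumes g: "square_integrable g" and ab: "a \<le> b"
  shows "set_integrable lborel {a..b} (\<lambda>x. cmod (g x))"
    and "(LINT x:{a..b}|lborel. cmod (g x)) \<le> sqrt (b - a) * norm_L2 g"
proof -
  define k where "k x = complex_of_real (indicator {a..b} x)" for x :: real
  have k2: "(cmod (k x))\<^sup>2 = indicator {a..b} x" for x
    by (simp add: k_def indicator_def)
  have k: "square_integrable k"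
    unfolding square_integrable_def k2 using ab by (auto simp: k_def[abs_def])
  have nk: "norm_L2 k = sqrt (b - a)"
    unfolding norm_L2_def k2 using ab by simp
  have eq: "cmod (k x * g x) = indicator {a..b} x *\<^sub>R cmod (g x)" for x
    by (simp add: k_def indicator_def)
  show "set_integrable lborel {a..b} (\<lambda>x. cmod (g x))"
    unfolding set_integrable_def eq[symmetric]
    using square_integrable_mult(1)[OF k g] by (rule integrable_norm)
  show "(LINT x:{a..b}|lborel. cmod (g x)) \<le> sqrt (b - a) * norm_L2 g"
    unfolding set_lebesgue_integral_def eq[symmetric] nk[symmetric]
    using k g by (rule square_integrable_mult(2))
qed

lemma square_integrable_set_integrable:
  fixes b :: "real \<Rightarrow> complex"
  assumes b: "square_integrable b"
  shows "set_integrable lborel {l..u} b"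
proof (cases "l \<le> u")
  case True
  have "set_integrable lborel {l..u} (\<lambda>x. cmod (b x))"
    by (rule set_integral_norm_le_norm_L2(1)[OF b True])
  then show ?thesis
    using square_integrableD(1)[OF b] unfolding set_integrable_def
    by (subst integrable_norm_iff[symmetric]) auto
qed (simp add: set_integrable_def)

section \<open>The Poisson and Cauchy kernels\<close>

definition poisson_kernel :: "real \<Rightarrow> real \<Rightarrow> real" where
  "poisson_kernel y t = y / (pi * (t\<^sup>2 + y\<^sup>2))"

lemma poisson_kernel_nonneg: "0 \<le> y \<Longrightarrow> 0 \<le> poisson_kernel y t"
  by (simp add: poisson_kernel_def)

lemma poisson_kernel_commute: "poisson_kernel y (a - b) = poisson_kernel y (b - a)"
  by (simp add: poisson_kernel_def power2_commute)

lemma poisson_kernel_measurable [measurable]: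
  "(\<lambda>t. poisson_kernel y t) \<in> borel_measurable borel"
  unfolding poisson_kernel_def by measurable

lemma poisson_kernel_le:
  assumes "0 < y" shows "poisson_kernel y t \<le> 1 / (pi * y)"
proof -
  have "y / (pi * (t\<^sup>2 + y\<^sup>2)) \<le> y / (pi * y\<^sup>2)"
    using assms by (intro divide_left_mono mult_left_mono) (auto intro!: mult_pos_pos add_nonneg_pos)
  also have "\<dots> = 1 / (pi * y)" using assms by (simp add: power2_eq_square)
  finally show ?thesis by (simp add: poisson_kernel_def)
qed

text \<open>
  The substitution \<open>t = x + y u\<close> reduces the total mass to the integral of \<open>1 / (1 + u\<^sup>2)\<close>, which is \<open>\<pi>\<close>.
\<close>
lemma has_bochner_integral_poisson_kernel:
  assumes y: "0 < y"
  shows "has_bochner_integral lborel (\<lambda>t. poisson_kernel y (t - x)) 1"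
proof -
  have si: "integrable lborel (\<lambda>x. inverse (1 + x\<^sup>2) :: real)"
    using integrable_inverse_1_plus_square by (simp add: set_integrable_def)
  have "(\<integral>x. inverse (1 + x\<^sup>2) \<partial>lborel) = pi"
    using LBINT_inverse_1_plus_square by (simp add: interval_lebesgue_integral_def set_lebesgue_integral_def)
  with si have h: "has_bochner_integral lborel (\<lambda>x. inverse (1 + x\<^sup>2) :: real) pi"
    by (simp add: has_bochner_integral_iff)
  have "has_bochner_integral lborel (\<lambda>t. inverse (1 + ((- x / y) + (1 / y) * t)\<^sup>2)) (pi /\<^sub>R \<bar>1/y\<bar>)"
    using lborel_has_bochner_integral_real_affine_iff[of "1/y" "\<lambda>x. inverse (1 + x\<^sup>2)" pi "- x / y"] h y
    by simp
  then have "has_bochner_integral lborel (\<lambda>t. 1 / (pi * y) * inverse (1 + ((- x / y) + (1 / y) * t)\<^sup>2)) (1 / (pi * y) * (pi /\<^sub>R \<bar>1/y\<bar>))"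
    by (rule has_bochner_integral_mult_right)
  moreover have "1 / (pi * y) * inverse (1 + ((- x / y) + (1 / y) * t)\<^sup>2) = poisson_kernel y (t - x)" for t
  proof -
    have "(- x / y) + (1 / y) * t = (t - x) / y" by (simp add: diff_divide_distrib)
    moreover have "1 + ((t - x) / y)\<^sup>2 = ((t - x)\<^sup>2 + y\<^sup>2) / y\<^sup>2" using y by (simp add: power_divide add_divide_distrib)
    ultimately show ?thesis using y by (simp add: poisson_kernel_def power2_eq_square)
  qed
  ultimately show ?thesis using y by simp
qed

lemma
  assumes y: "0 < y"
  shows integrable_poisson_kernel: "integrable lborel (\<lambda>t. poisson_kernel y (t - x))"
    and integral_poisson_kernel: "(\<integral>t. poisson_kernel y (t - x) \<partial>lborel) = 1"
    and nn_integral_poisson_kernel: "(\<integral>\<^sup>+t. ennreal (poisson_kernel y (t - x)) \<partial>lborel) = 1"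
  using has_bochner_integral_poisson_kernel[OF y, of x] y
  by (auto simp: has_bochner_integral_iff nn_integral_eq_integral poisson_kernel_nonneg)

text \<open>
  The squared modulus of the Cauchy kernel is \<open>\<pi> / \<bar>Im w\<bar>\<close> times a Poisson kernel, which has mass \<open>1\<close>.
\<close>
lemma cauchy_kernel_square_integrable:
  assumes w: "Im w \<noteq> 0"
  shows "square_integrable (\<lambda>x. 1 / (complex_of_real x - w))"
    and "norm_L2 (\<lambda>x. 1 / (complex_of_real x - w)) = sqrt (pi / \<bar>Im w\<bar>)"
proof -
  have eq: "(cmod (1 / (complex_of_real x - w)))\<^sup>2 = pi / \<bar>Im w\<bar> * poisson_kernel \<bar>Im w\<bar> (x - Re w)" for x
    using w by (simp add: norm_divide power_divide cmod_power2 poisson_kernel_def)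
  have i: "integrable lborel (\<lambda>x. poisson_kernel \<bar>Im w\<bar> (x - Re w))"
    using w by (intro integrable_poisson_kernel) auto
  show "square_integrable (\<lambda>x. 1 / (complex_of_real x - w))"
    unfolding square_integrable_def eq using i by auto
  show "norm_L2 (\<lambda>x. 1 / (complex_of_real x - w)) = sqrt (pi / \<bar>Im w\<bar>)"
    unfolding norm_L2_def eq using w by (simp add: integral_poisson_kernel)
qed

lemma poisson_kernel_square_integrable:
  assumes y: "0 < y"
  shows "square_integrable (\<lambda>t. complex_of_real (poisson_kernel y (t - x)))"
proof -
  have "square_integrable (\<lambda>t. complex_of_real (poisson_kernel y (t - x)))
    \<longleftrightarrow> integrable lborel (\<lambda>t. (poisson_kernel y (t - x))\<^sup>2)"
    by (auto simp: square_integrable_def)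
  also have \<dots>
  proof (rule Bochner_Integration.integrable_bound)
    show "integrable lborel (\<lambda>t. 1 / (pi * y) * poisson_kernel y (t - x))"
      using integrable_poisson_kernel[OF y] by auto
    show "AE t in lborel. norm ((poisson_kernel y (t - x))\<^sup>2) \<le> norm (1 / (pi * y) * poisson_kernel y (t - x))"
      using y mult_right_mono[OF poisson_kernel_le[OF y], of "poisson_kernel y (t - x)" for t]
      by (auto simp: power2_eq_square poisson_kernel_nonneg abs_mult)
  qed auto
  finally show ?thesis .
qed

text \<open>
  This decomposition lets the Cauchy formula follow from the Poisson formula once the contribution of the
  pole \<open>cnj w\<close> below the axis is known to vanish.
\<close>
lemma poisson_kernel_eq_cauchy:
  assumes "Im w > 0"
  shows "complex_of_real (poisson_kernel (Im w) (t - Re w))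
     = (1 / (of_real t - w) - 1 / (of_real t - cnj w)) / (2 * of_real pi * \<i>)"
proof -
  have nz: "of_real t - w \<noteq> 0" "of_real t - cnj w \<noteq> 0"
    using assms by (auto simp: complex_eq_iff)
  have m: "(of_real t - w) * (of_real t - cnj w) = complex_of_real ((t - Re w)\<^sup>2 + (Im w)\<^sup>2)"
    by (simp add: complex_eq_iff power2_eq_square algebra_simps)
  have "1 / (of_real t - w) - 1 / (of_real t - cnj w)
      = (w - cnj w) / ((of_real t - w) * (of_real t - cnj w))"
    using nz by (simp add: field_simps)
  also have "\<dots> = (2 * of_real (Im w) * \<i>) / complex_of_real ((t - Re w)\<^sup>2 + (Im w)\<^sup>2)"
    unfolding m by (simp add: complex_eq_iff)
  finally show ?thesis
    by (simp add: poisson_kernel_def)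
qed

section \<open>The Hardy space and its horizontal slices\<close>

lemma Complex_in_upper_half_plane [simp]: "Complex x y \<in> \<complex>\<^sub>+ \<longleftrightarrow> 0 < y"
  by (simp add: upper_half_plane_def)

lemma upper_half_plane_open: "open \<complex>\<^sub>+"
  unfolding upper_half_plane_def by (rule open_halfspace_Im_gt)

lemma upper_half_plane_convex: "convex \<complex>\<^sub>+"
  unfolding upper_half_plane_def by (rule convex_halfspace_Im_gt)

definition slice :: "(complex \<Rightarrow> complex) \<Rightarrow> real \<Rightarrow> real \<Rightarrow> complex" where
  "slice f y x = f (Complex x y)"

lemma slice_measurable:
  assumes f: "continuous_on \<complex>\<^sub>+ f" and y: "0 < y"
  shows "continuous_on UNIV (slice f y)" "slice f y \<in> borel_measurable borel"
proof -
  have "continuous_on UNIV (\<lambda>x. Complex x y)"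
    unfolding Complex_eq by (intro continuous_intros)
  then have "continuous_on UNIV (\<lambda>x. f (Complex x y))"
    by (rule continuous_on_compose2[OF f]) (use y in auto)
  then show "continuous_on UNIV (slice f y)" "slice f y \<in> borel_measurable borel"
    by (auto simp: slice_def[abs_def] intro: borel_measurable_continuous_onI)
qed

lemma hardy2_holomorphic: "f \<in> hardy2 \<Longrightarrow> f holomorphic_on \<complex>\<^sub>+"
  by (simp add: hardy2_def)

lemma hardy2_slices:
  assumes "f \<in> hardy2"
  obtains E where "0 \<le> E" "\<And>y. 0 < y \<Longrightarrow> square_integrable (slice f y)"
    "\<And>y. 0 < y \<Longrightarrow> norm_L2 (slice f y) \<le> E"
proof -
  have hol: "f holomorphic_on \<complex>\<^sub>+" using assms by (rule hardy2_holomorphic)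
  define S where "S = (SUP y\<in>{0<..}. \<integral>\<^sup>+x. ennreal ((cmod (f (Complex x y)))\<^sup>2) \<partial>lborel)"
  have "S < \<infinity>" using assms by (simp add: hardy2_def S_def)
  then obtain C where C: "S = ennreal C" "0 \<le> C" by (cases S) auto
  have le: "(\<integral>\<^sup>+x. ennreal ((cmod (slice f y x))\<^sup>2) \<partial>lborel) \<le> ennreal C" if "0 < y" for y
    unfolding C(1)[symmetric] S_def slice_def by (rule SUP_upper) (use that in auto)
  have m: "slice f y \<in> borel_measurable lborel" if "0 < y" for y
    using slice_measurable(2)[OF holomorphic_on_imp_continuous_on[OF hol] that] by simp
  show ?thesis
  proof (rule that[of "sqrt C"])
    show "norm_L2 (slice f y) \<le> sqrt C" if "0 < y" for y
      using square_integrableI_bounded(2)[OF m[OF that] le[OF that] C(2)]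
      by (simp add: real_le_rsqrt)
  qed (use square_integrableI_bounded(1)[OF m le C(2)] C in auto)
qed

lemma hardy2I:
  assumes "f holomorphic_on \<complex>\<^sub>+" "\<And>y. 0 < y \<Longrightarrow> square_integrable (slice f y)"
    "\<And>y. 0 < y \<Longrightarrow> norm_L2 (slice f y) \<le> E"
  shows "f \<in> hardy2"
proof -
  have "(\<integral>\<^sup>+x. ennreal ((cmod (f (Complex x y)))\<^sup>2) \<partial>lborel) \<le> ennreal (E\<^sup>2)" if "0 < y" for y
    using square_integrable_nn_integral[OF assms(2)[OF that]] power_mono[OF assms(3)[OF that] norm_L2_nonneg, of 2]
    by (simp add: slice_def ennreal_leI)
  then have "(SUP y\<in>{0<..}. \<integral>\<^sup>+x. ennreal ((cmod (f (Complex x y)))\<^sup>2) \<partial>lborel) \<le> ennreal (E\<^sup>2)"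
    by (intro SUP_least) auto
  then show ?thesis
    using assms(1) unfolding hardy2_def by (auto intro: order_le_less_trans)
qed

lemma hardy2_norm_eq: "hardy2_norm f = norm_L2 (bdry f)"
  by (simp add: hardy2_norm_def norm_L2_def)

lemma hardy2_mult_bounded:
  assumes f: "f \<in> hardy2" and g: "g holomorphic_on \<complex>\<^sub>+" and C: "\<And>z. z \<in> \<complex>\<^sub>+ \<Longrightarrow> cmod (g z) \<le> C"
  shows "(\<lambda>z. g z * f z) \<in> hardy2"
proof -
  obtain E where E: "0 \<le> E" "\<And>y. 0 < y \<Longrightarrow> square_integrable (slice f y)"
    "\<And>y. 0 < y \<Longrightarrow> norm_L2 (slice f y) \<le> E" using hardy2_slices[OF f] by blast
  have C0: "0 \<le> C" using C[of "\<i>"] norm_ge_zero[of "g \<i>"] by (simp add: upper_half_plane_def del: norm_ge_zero)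
  have hol: "(\<lambda>z. g z * f z) holomorphic_on \<complex>\<^sub>+"
    by (intro holomorphic_intros g hardy2_holomorphic[OF f])
  have sl: "square_integrable (slice (\<lambda>z. g z * f z) y)"
    "norm_L2 (slice (\<lambda>z. g z * f z) y) \<le> C * norm_L2 (slice f y)" if y: "0 < y" for y
  proof -
    have m: "slice (\<lambda>z. g z * f z) y \<in> borel_measurable lborel"
      using slice_measurable(2)[OF holomorphic_on_imp_continuous_on[OF hol] y] by simp
    have le: "AE x in lborel. cmod (slice (\<lambda>z. g z * f z) y x) \<le> C * cmod (slice f y x)"
      using C y by (intro AE_I2) (auto simp: slice_def norm_mult intro!: mult_right_mono)
    show "square_integrable (slice (\<lambda>z. g z * f z) y)"
      "norm_L2 (slice (\<lambda>z. g z * f z) y) \<le> C * norm_L2 (slice f y)"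
      using square_integrable_dominated[OF E(2)[OF y] m le C0] by auto
  qed
  show ?thesis
  proof (rule hardy2I[OF hol sl(1)])
    fix y :: real assume y: "0 < y"
    show "norm_L2 (slice (\<lambda>z. g z * f z) y) \<le> C * E"
      using sl(2)[OF y] mult_left_mono[OF E(3)[OF y] C0] by linarith
  qed
qed

lemma hardy2_diff:
  assumes f: "f \<in> hardy2" and g: "g \<in> hardy2"
  shows "(\<lambda>z. f z - g z) \<in> hardy2"
proof -
  obtain E where E: "0 \<le> E" "\<And>y. 0 < y \<Longrightarrow> square_integrable (slice f y)"
    "\<And>y. 0 < y \<Longrightarrow> norm_L2 (slice f y) \<le> E" using hardy2_slices[OF f] by blast
  obtain D where D: "0 \<le> D" "\<And>y. 0 < y \<Longrightarrow> square_integrable (slice g y)"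
    "\<And>y. 0 < y \<Longrightarrow> norm_L2 (slice g y) \<le> D" using hardy2_slices[OF g] by blast
  have eq: "slice (\<lambda>z. f z - g z) y = (\<lambda>x. slice f y x - slice g y x)" for y
    by (simp add: slice_def fun_eq_iff)
  show ?thesis
  proof (rule hardy2I)
    show "(\<lambda>z. f z - g z) holomorphic_on \<complex>\<^sub>+"
      by (intro holomorphic_intros hardy2_holomorphic f g)
    fix y :: real assume y: "0 < y"
    show "square_integrable (slice (\<lambda>z. f z - g z) y)"
      unfolding eq by (rule norm_L2_diff_expand(1)[OF E(2)[OF y] D(2)[OF y]])
    show "norm_L2 (slice (\<lambda>z. f z - g z) y) \<le> E + D"
      unfolding eq using norm_L2_diff_le[OF E(2)[OF y] D(2)[OF y]] E(3)[OF y] D(3)[OF y] by linarith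
  qed
qed

text \<open>
  On the line at height \<open>y\<close> the function is a Cauchy kernel with pole at distance \<open>Im w + y\<close>, so its slices
  shrink as \<open>y\<close> grows.
\<close>
lemma conj_pole_in_hardy2:
  assumes w: "w \<in> \<complex>\<^sub>+"
  shows "(\<lambda>z. 1 / (z - cnj w)) \<in> hardy2"
proof -
  have v: "0 < Im w" using w by (simp add: upper_half_plane_def)
  have eq: "slice (\<lambda>z. 1 / (z - cnj w)) y = (\<lambda>x. 1 / (complex_of_real x - (cnj w - \<i> * of_real y)))" for y
    by (simp add: slice_def fun_eq_iff Complex_eq algebra_simps)
  show ?thesis
  proof (rule hardy2I)
    show "(\<lambda>z. 1 / (z - cnj w)) holomorphic_on \<complex>\<^sub>+"
      using v by (intro holomorphic_intros) (auto simp: upper_half_plane_def complex_eq_iff)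
    fix y :: real assume y: "0 < y"
    have im: "Im (cnj w - \<i> * of_real y) = - (Im w + y)" by simp
    show "square_integrable (slice (\<lambda>z. 1 / (z - cnj w)) y)"
      unfolding eq by (rule cauchy_kernel_square_integrable(1)) (use v y in \<open>simp add: im\<close>)
    have "norm_L2 (slice (\<lambda>z. 1 / (z - cnj w)) y) = sqrt (pi / \<bar>Im (cnj w - \<i> * of_real y)\<bar>)"
      unfolding eq by (rule cauchy_kernel_square_integrable(2)) (use v y in \<open>simp add: im\<close>)
    also have "\<dots> \<le> sqrt (pi / Im w)"
      unfolding im using v y by (intro real_sqrt_le_mono divide_left_mono) auto
    finally show "norm_L2 (slice (\<lambda>z. 1 / (z - cnj w)) y) \<le> sqrt (pi / Im w)" .
  qed
qed

text \<open>
  A primitive \<open>F\<close> of \<open>f\<close> has increments \<open>F (\<zeta> + h) - F \<zeta>\<close> of modulus at most \<open>sqrt h E\<close>, by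
  Cauchy-Schwarz on a horizontal segment.  For fixed \<open>h\<close> this increment is a bounded holomorphic function
  of \<open>\<zeta>\<close>, so the Cauchy inequality bounds its derivative \<open>f (\<zeta> + h) - f \<zeta>\<close>.  Hence \<open>f\<close> varies little over
  a horizontal segment of length \<open>Im z\<close>, and its mean over that segment is again controlled by
  Cauchy-Schwarz.
\<close>
lemma hardy2_pointwise_bound:
  assumes hol: "f holomorphic_on \<complex>\<^sub>+"
    and sq: "\<And>y. 0 < y \<Longrightarrow> square_integrable (slice f y)"
    and E: "\<And>y. 0 < y \<Longrightarrow> norm_L2 (slice f y) \<le> E" and z: "z \<in> \<complex>\<^sub>+"
  shows "cmod (f z) \<le> 3 * E / sqrt (Im z)"
proof -
  define v where "v = Im z"
  have v: "0 < v" using z by (simp add: v_def upper_half_plane_def)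
  have E0: "0 \<le> E" using E[of 1] norm_L2_nonneg[of "slice f 1"] by simp
  have interval: "(LINT x:{a..b}|lborel. cmod (slice f y x)) \<le> sqrt (b - a) * E" if "a \<le> b" "0 < y" for a b y
    by (rule order_trans[OF set_integral_norm_le_norm_L2(2)[OF sq[OF that(2)] that(1)]])
      (use E[OF that(2)] that in \<open>auto intro: mult_left_mono\<close>)
  obtain F where F: "\<And>\<zeta>. \<zeta> \<in> \<complex>\<^sub>+ \<Longrightarrow> (F has_field_derivative f \<zeta>) (at \<zeta> within \<complex>\<^sub>+)"
    using holomorphic_convex_primitive'[OF upper_half_plane_convex upper_half_plane_open hol] by metis
  then have F': "(F has_field_derivative f \<zeta>) (at \<zeta>)" if "\<zeta> \<in> \<complex>\<^sub>+" for \<zeta>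
    using that at_within_open[OF that upper_half_plane_open] by metis
  have Fdiff: "cmod (F (\<zeta> + of_real h) - F \<zeta>) \<le> sqrt h * E" if "\<zeta> \<in> \<complex>\<^sub>+" "0 \<le> h" for \<zeta> h
  proof -
    define a where "a = Re \<zeta>"
    define y where "y = Im \<zeta>"
    have y: "0 < y" using that by (simp add: y_def upper_half_plane_def)
    have eqs: "Complex (a + h) y = \<zeta> + of_real h" "Complex a y = \<zeta>"
      by (simp_all add: a_def y_def complex_eq_iff)
    have "(slice f y has_integral (F (Complex (a + h) y) - F (Complex a y))) {a..a + h}"
      unfolding slice_def[abs_def]
    proof (rule fundamental_theorem_of_calculus)
      show "a \<le> a + h" using that by simp
      fix x assume "x \<in> {a..a+h}"
      have "((\<lambda>x. Complex x y) has_vector_derivative 1) (at x within {a..a+h})"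
        unfolding Complex_eq by (auto intro!: derivative_eq_intros)
      then show "((\<lambda>x. F (Complex x y)) has_vector_derivative f (Complex x y)) (at x within {a..a+h})"
        using field_vector_diff_chain_within[of "\<lambda>x. Complex x y" 1 x "{a..a+h}" F "f (Complex x y)"]
          has_field_derivative_at_within[OF F'[of "Complex x y"]] y by (simp add: o_def)
    qed
    moreover have "set_integrable lborel {a..a+h} (\<lambda>x. cmod (slice f y x))"
      using set_integral_norm_le_norm_L2(1)[OF sq[OF y], of a "a+h"] that by simp
    then have "((\<lambda>x. cmod (slice f y x)) has_integral (LINT x:{a..a+h}|lborel. cmod (slice f y x))) {a..a+h}"
      by (metis has_integral_integral set_borel_integral_eq_integral)
    ultimately have "cmod (F (Complex (a + h) y) - F (Complex a y)) \<le> (LINT x:{a..a+h}|lborel. cmod (slice f y x))"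
      using integral_norm_bound_integral[of "slice f y" "{a..a+h}" "\<lambda>x. cmod (slice f y x)"]
      by (metis has_integral_integrable integral_unique order_refl)
    also have "\<dots> \<le> sqrt h * E" using interval[of a "a+h" y] y that by simp
    finally show ?thesis unfolding eqs .
  qed
  have osc: "cmod (f z) \<le> cmod (f (z + of_real h)) + 2 * E / sqrt v" if h: "0 \<le> h" "h \<le> v" for h
  proof -
    define D where "D \<zeta> = F (\<zeta> + of_real h) - F \<zeta>" for \<zeta>
    have D': "(D has_field_derivative (f (\<zeta> + of_real h) - f \<zeta>)) (at \<zeta>)" if "\<zeta> \<in> \<complex>\<^sub>+" for \<zeta>
    proof -
      have "\<zeta> + of_real h \<in> \<complex>\<^sub>+" using that by (simp add: upper_half_plane_def)
      then show ?thesis unfolding D_def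
        using F'[OF that] DERIV_shift[of F "f (\<zeta> + of_real h)" \<zeta> "of_real h"] F'
        by (auto intro!: derivative_intros)
    qed
    have sub: "cball z (v/2) \<subseteq> \<complex>\<^sub>+"
    proof
      fix u assume "u \<in> cball z (v/2)"
      then have "\<bar>Im (z - u)\<bar> \<le> v / 2" using abs_Im_le_cmod[of "z - u"] by (auto simp: dist_norm)
      then have "0 < Im u" using v unfolding v_def minus_complex.sel by linarith
      then show "u \<in> \<complex>\<^sub>+" by (simp add: upper_half_plane_def)
    qed
    have holD: "D holomorphic_on \<complex>\<^sub>+"
      using D' by (meson DERIV_subset field_differentiable_at_within field_differentiable_def holomorphic_on_def)
    have "norm ((deriv ^^ 1) D z) \<le> (fact 1) * (sqrt h * E) / (v/2)^1"
    proof (rule Cauchy_inequality)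
      show "D holomorphic_on ball z (v/2)"
        using holD sub ball_subset_cball by (metis holomorphic_on_subset order_trans)
      show "continuous_on (cball z (v/2)) D"
        using holomorphic_on_imp_continuous_on[OF holD] sub by (rule continuous_on_subset)
      show "norm (D x) \<le> sqrt h * E" if "norm (z - x) = v/2" for x
        unfolding D_def by (rule Fdiff) (use that sub h in \<open>auto simp: dist_norm\<close>)
    qed (use v in simp)
    moreover have "deriv D z = f (z + of_real h) - f z"
      using D'[OF z] by (rule DERIV_imp_deriv)
    ultimately have "cmod (f (z + of_real h) - f z) \<le> 2 * (sqrt h * E) / v" by (simp add: mult_ac)
    also have "\<dots> \<le> 2 * (sqrt v * E) / v"
      using h v E0 by (intro divide_right_mono mult_left_mono mult_right_mono) auto
    also have "\<dots> = 2 * E / sqrt v"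
      using v by (simp add: field_simps power2_eq_square[symmetric])
    finally show ?thesis using norm_triangle_sub[of "f z" "f (z + of_real h)"] by (simp add: norm_minus_commute)
  qed
  \<comment> \<open>Average the oscillation bound over \<open>0 \<le> h \<le> v\<close>.\<close>
  let ?c = "cmod (f z) - 2 * E / sqrt v"
  have "v * ?c = (LINT x:{Re z..Re z + v}|lborel. ?c)"
    using v by (simp add: set_integral_const)
  also have "\<dots> \<le> (LINT x:{Re z..Re z + v}|lborel. cmod (slice f v x))"
  proof (rule set_integral_mono)
    show "set_integrable lborel {Re z..Re z + v} (\<lambda>x. cmod (slice f v x))"
      using set_integral_norm_le_norm_L2(1)[OF sq[OF v]] v by simp
    fix x assume x: "x \<in> {Re z..Re z + v}"
    have "Complex x v = z + of_real (x - Re z)" by (simp add: complex_eq_iff v_def)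
    then show "?c \<le> cmod (slice f v x)"
      using osc[of "x - Re z"] x by (simp add: slice_def)
  qed (intro borel_integrable_atLeastAtMost' continuous_intros)
  also have "\<dots> \<le> sqrt v * E" using interval[of "Re z" "Re z + v" v] v by simp
  finally have "?c \<le> sqrt v * E / v" using v by (simp add: field_simps)
  also have "\<dots> = E / sqrt v" using v by (simp add: field_simps power2_eq_square[symmetric])
  finally have "cmod (f z) \<le> 3 * E / sqrt v" by (simp add: field_simps)
  then show ?thesis by (simp add: v_def)
qed

section \<open>The Poisson formula above a horizontal line\<close>

text \<open>
  With \<open>F\<close> the translate of \<open>f\<close> by \<open>\<i> \<eta>\<close>, the function \<open>(F z - F w) / ((z - w) (z - cnj w))\<close> has a removable
  singularity at \<open>w\<close> and is \<open>O(1/\<bar>z\<bar>\<^sup>2)\<close> in the upper half-plane.  Integrating it over large half discs shows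
  that its integral over the real line vanishes.  On the line, \<open>1 / ((t - w) (t - cnj w))\<close> is \<open>\<pi> / y\<close> times
  the Poisson kernel, so the assertion follows from the total mass \<open>1\<close>.
\<close>
lemma poisson_formula_bounded:
  assumes hol: "f holomorphic_on \<complex>\<^sub>+" and \<eta>: "0 < \<eta>" and y: "0 < y"
    and B: "\<And>z. \<eta> \<le> Im z \<Longrightarrow> cmod (f z) \<le> B"
  shows "f (Complex x (\<eta> + y)) = (\<integral>t. poisson_kernel y (t - x) * slice f \<eta> t \<partial>lborel)"
proof -
  define F where "F z = f (z + \<i> * of_real \<eta>)" for z
  define w where "w = Complex x y"
  define S where "S = {z. Im z > - \<eta>} \<inter> {z. Im z > - y}"
  define Q where "Q z = (if z = w then deriv F w else (F z - F w) / (z - w))" for z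
  define G where "G z = Q z / (z - cnj w)" for z
  have w: "Im w = y" "Re w = x" by (simp_all add: w_def)
  have B0: "0 \<le> B" using B[of "\<i> * of_real \<eta>"] norm_ge_zero[of "f (\<i> * of_real \<eta>)"] by (simp del: norm_ge_zero)
  have FB: "cmod (F z) \<le> B" if "0 \<le> Im z" for z
    unfolding F_def by (rule B) (use that in simp)
  have S: "open S" "convex S" "w \<in> S" "\<And>t. of_real t \<in> S"
    unfolding S_def using y \<eta> w
    by (auto intro!: open_Int convex_Int open_halfspace_Im_gt convex_halfspace_Im_gt)
  have holF: "F holomorphic_on S"
    unfolding F_def
    by (rule holomorphic_on_compose_gen[OF _ hol, unfolded o_def])
      (auto intro!: holomorphic_intros simp: S_def upper_half_plane_def)
  have "Q holomorphic_on S"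
    unfolding Q_def by (rule pole_lemma_open[OF holF S(1)])
  then have holG: "G holomorphic_on S"
    unfolding G_def by (intro holomorphic_intros) (auto simp: S_def w)
  have G_real: "G (of_real t) = pi / y * (poisson_kernel y (t - x) * (F (of_real t) - F w))" for t
  proof -
    have "of_real t \<noteq> w" using w y by auto
    moreover have "(of_real t - w) * (of_real t - cnj w) = complex_of_real ((t - x)\<^sup>2 + y\<^sup>2)"
      using w by (simp add: complex_eq_iff power2_eq_square algebra_simps)
    ultimately show ?thesis using y
      by (simp add: G_def Q_def poisson_kernel_def divide_simps)
  qed
  have slice: "slice f \<eta> t = F (of_real t)" for t
    unfolding slice_def F_def by (simp add: Complex_eq)
  have [measurable]: "(\<lambda>t. F (of_real t)) \<in> borel_measurable borel"
    using slice_measurable(2)[OF holomorphic_on_imp_continuous_on[OF hol] \<eta>] by (simp add: slice cong: measurable_cong)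
  have iF: "integrable lborel (\<lambda>t. poisson_kernel y (t - x) * F (of_real t))"
  proof (rule Bochner_Integration.integrable_bound)
    show "integrable lborel (\<lambda>t. B * poisson_kernel y (t - x))"
      using integrable_poisson_kernel[OF y] by auto
    show "AE t in lborel. norm (poisson_kernel y (t - x) * F (of_real t)) \<le> norm (B * poisson_kernel y (t - x))"
      using FB y B0 poisson_kernel_nonneg[of y]
      by (auto simp: norm_mult abs_mult mult.commute intro!: AE_I2 mult_right_mono)
  qed auto
  have iP: "integrable lborel (\<lambda>t. poisson_kernel y (t - x) * F w)"
    using integrable_poisson_kernel[OF y] by (intro integrable_mult_left) auto
  have iG: "integrable lborel (\<lambda>t. G (of_real t))"
    unfolding G_real right_diff_distrib using iF iP by auto
  \<comment> \<open>The radius exceeds \<open>2 \<bar>w\<bar>\<close>, so both poles keep distance at least \<open>R / 2\<close> from the arc, where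
      \<open>\<bar>G\<bar> \<le> 2 B / (R / 2)\<^sup>2\<close>; the arc has length \<open>\<pi> R\<close>.\<close>
  have arc: "cmod (LINT t:{-R..R}|lborel. G (of_real t)) \<le> 8 * B * pi / R" if R: "R > 2 * cmod w" "R > 0" for R
  proof -
    let ?a = "part_circlepath 0 R 0 pi"
    let ?l = "linepath (- of_real R) (of_real R) :: real \<Rightarrow> complex"
    have a_im: "0 \<le> Im z \<and> cmod z = R" if "z \<in> path_image ?a" for z
      using that R by (auto simp: path_image_part_circlepath Re_exp Im_exp norm_mult sin_ge_zero intro!: mult_nonneg_nonneg)
    have aS: "path_image ?a \<subseteq> S"
      using a_im y \<eta> by (force simp: S_def)
    have lS: "path_image ?l \<subseteq> S"
      using S(4)[of "-R"] S(4)[of R] S(2) by (simp add: closed_segment_subset)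
    have ea: "exp (\<i> * complex_of_real pi) = -1"
      by (simp add: exp_Euler)
    have int0: "(G has_contour_integral 0) (?l +++ ?a)"
    proof (rule Cauchy_theorem_convex_simple[OF holG S(2)])
      show "path_image (?l +++ ?a) \<subseteq> S"
        using aS lS by (metis path_image_join_subset Un_least order_trans)
    qed (auto simp: ea intro!: valid_path_join)
    have ia: "G contour_integrable_on ?a"
      by (rule contour_integrable_holomorphic_simple[OF holG S(1) _ aS]) auto
    have il: "G contour_integrable_on ?l"
      by (rule contour_integrable_holomorphic_simple[OF holG S(1) _ lS]) auto
    have sum: "contour_integral ?l G + contour_integral ?a G = 0"
      using contour_integral_join[OF il ia] contour_integral_unique[OF int0] by simp
    have "cmod (contour_integral ?a G) \<le> (8 * B / R\<^sup>2) * R * \<bar>pi - 0\<bar>"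
    proof (rule contour_integral_bound_part_circlepath[OF ia])
      fix z assume "z \<in> path_image ?a"
      then have z: "0 \<le> Im z" "cmod z = R" using a_im by auto
      have zw: "R / 2 \<le> cmod (z - w)" "R / 2 \<le> cmod (z - cnj w)"
        using norm_triangle_ineq2[of z w] norm_triangle_ineq2[of z "cnj w"] z R by auto
      then have "z \<noteq> w" using R by auto
      then have "cmod (G z) = cmod (F z - F w) / (cmod (z - w) * cmod (z - cnj w))"
        by (simp add: G_def Q_def norm_divide norm_mult)
      also have "\<dots> \<le> (2 * B) / (R / 2 * (R / 2))"
        using zw R B0 FB[OF z(1)] FB[of w] w y norm_triangle_ineq4[of "F z" "F w"]
        by (intro frac_le mult_mono) auto
      also have "\<dots> = 8 * B / R\<^sup>2" by (simp add: power2_eq_square)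
      finally show "cmod (G z) \<le> 8 * B / R\<^sup>2" .
    qed (use R B0 in auto)
    then have "cmod (contour_integral ?l G) \<le> 8 * B * pi / R"
      using sum R by (simp add: power2_eq_square field_simps eq_neg_iff_add_eq_0[symmetric])
    moreover have "contour_integral ?l G = integral {-R..R} (\<lambda>t. G (of_real t))"
      using contour_integral_linepath_Reals_eq[of "- of_real R" "of_real R" G] R by simp
    moreover have "set_integrable lborel {-R..R} (\<lambda>t. G (of_real t))"
      unfolding set_integrable_def using iG by (rule integrable_mult_indicator[rotated]) simp
    ultimately show ?thesis by (simp add: set_borel_integral_eq_integral(2))
  qed
  have "(\<lambda>n. \<integral>t. indicator {- real n..real n} t *\<^sub>R G (of_real t) \<partial>lborel) \<longlonglongrightarrow> (\<integral>t. G (of_real t) \<partial>lborel)"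
  proof (rule integral_dominated_convergence)
    show "integrable lborel (\<lambda>t. cmod (G (of_real t)))" using iG by (rule integrable_norm)
    show "AE t in lborel. (\<lambda>n. indicator {- real n..real n} t *\<^sub>R G (of_real t)) \<longlonglongrightarrow> G (of_real t)"
    proof (rule AE_I2)
      fix t :: real
      have "\<forall>\<^sub>F n in sequentially. indicator {- real n..real n} t *\<^sub>R G (of_real t) = G (of_real t)"
        using eventually_ge_at_top[of "nat \<lceil>\<bar>t\<bar>\<rceil>"]
      proof eventually_elim
        case (elim n)
        then have "\<bar>t\<bar> \<le> real n" by linarith
        then show ?case by (auto simp: indicator_def abs_le_iff)
      qed
      then show "(\<lambda>n. indicator {- real n..real n} t *\<^sub>R G (of_real t)) \<longlonglongrightarrow> G (of_real t)"
        by (rule tendsto_eventually)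
    qed
  qed (use iG in \<open>auto simp: indicator_def\<close>)
  moreover have "(\<lambda>n. \<integral>t. indicator {- real n..real n} t *\<^sub>R G (of_real t) \<partial>lborel) \<longlonglongrightarrow> 0"
  proof (rule Lim_null_comparison)
    show "(\<lambda>n. 8 * B * pi / real n) \<longlonglongrightarrow> 0" by real_asymp
    show "\<forall>\<^sub>F n in sequentially. norm (\<integral>t. indicator {- real n..real n} t *\<^sub>R G (of_real t) \<partial>lborel) \<le> 8 * B * pi / real n"
      using eventually_gt_at_top[of "nat \<lceil>2 * cmod w\<rceil>"]
    proof eventually_elim
      case (elim n)
      then have "real n > 2 * cmod w" by linarith
      then show ?case using arc[of "real n"] norm_ge_zero[of w] by (simp add: set_lebesgue_integral_def del: norm_ge_zero)
    qed
  qed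
  ultimately have "(\<integral>t. G (of_real t) \<partial>lborel) = 0" by (rule LIMSEQ_unique)
  then have "(\<integral>t. poisson_kernel y (t - x) * F (of_real t) - poisson_kernel y (t - x) * F w \<partial>lborel) = 0"
    unfolding G_real right_diff_distrib[symmetric] using y by simp
  moreover have "(\<integral>t. poisson_kernel y (t - x) * F w \<partial>lborel) = F w"
    using integral_poisson_kernel[OF y, of x] integrable_poisson_kernel[OF y, of x] by simp
  ultimately have "(\<integral>t. poisson_kernel y (t - x) * F (of_real t) \<partial>lborel) = F w"
    using iF iP by simp
  moreover have "F w = f (Complex x (\<eta> + y))"
    unfolding F_def w_def by (rule arg_cong[of _ _ f]) (simp add: complex_eq_iff)
  ultimately show ?thesis by (simp add: slice)
qed

lemma hardy2_poisson_formula: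
  assumes f: "f \<in> hardy2" and \<eta>: "0 < \<eta>" and y: "0 < y"
  shows "f (Complex x (\<eta> + y)) = (\<integral>t. poisson_kernel y (t - x) * slice f \<eta> t \<partial>lborel)"
proof -
  obtain E where E: "0 \<le> E" "\<And>y. 0 < y \<Longrightarrow> square_integrable (slice f y)"
    "\<And>y. 0 < y \<Longrightarrow> norm_L2 (slice f y) \<le> E" using hardy2_slices[OF f] by blast
  show ?thesis
  proof (rule poisson_formula_bounded[OF hardy2_holomorphic[OF f] \<eta> y])
    fix z :: complex assume z: "\<eta> \<le> Im z"
    have "cmod (f z) \<le> 3 * E / sqrt (Im z)"
      by (rule hardy2_pointwise_bound[OF hardy2_holomorphic[OF f] E(2,3)])
        (use z \<eta> in \<open>auto simp: upper_half_plane_def\<close>)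
    also have "\<dots> \<le> 3 * E / sqrt \<eta>" using z \<eta> E(1) by (intro divide_left_mono) auto
    finally show "cmod (f z) \<le> 3 * E / sqrt \<eta>" .
  qed
qed

section \<open>Convergence of the slices in mean\<close>

text \<open>
  Fubini's theorem and the symmetry of the kernel.  The double integral converges absolutely because
  \<open>\<bar>f t\<bar> \<bar>g x\<bar> \<le> \<bar>f t\<bar>\<^sup>2 + \<bar>g x\<bar>\<^sup>2\<close> and the kernel has mass \<open>1\<close> in each variable.
\<close>
lemma poisson_convolution_symmetric:
  fixes f g :: "real \<Rightarrow> complex"
  assumes f: "square_integrable f" and g: "square_integrable g" and s: "0 < s"
  shows "(\<integral>x. (\<integral>t. poisson_kernel s (t - x) * f t \<partial>lborel) * g x \<partial>lborel)
       = (\<integral>t. f t * (\<integral>x. poisson_kernel s (x - t) * g x \<partial>lborel) \<partial>lborel)"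
proof -
  note [measurable] = square_integrableD(2)[OF f] square_integrableD(2)[OF g]
  let ?K = "\<lambda>x t. complex_of_real (poisson_kernel s (t - x)) * f t * g x"
  have mK: "(\<lambda>(x, t). ?K x t) \<in> borel_measurable (lborel \<Otimes>\<^sub>M lborel)"
    unfolding poisson_kernel_def by measurable
  have "integrable (lborel \<Otimes>\<^sub>M lborel) (\<lambda>(x, t). ?K x t)"
  proof (rule integrableI_bounded[OF mK])
    let ?p = "\<lambda>x t. ennreal (poisson_kernel s (t - x))"
    have mf: "(\<lambda>(x, t). ?p x t * ennreal ((cmod (f t))\<^sup>2)) \<in> borel_measurable (lborel \<Otimes>\<^sub>M lborel)"
      and mg: "(\<lambda>(x, t). ?p x t * ennreal ((cmod (g x))\<^sup>2)) \<in> borel_measurable (lborel \<Otimes>\<^sub>M lborel)"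
      unfolding poisson_kernel_def split_beta' by measurable
    have "(\<integral>\<^sup>+p. ennreal (norm (case p of (x, t) \<Rightarrow> ?K x t)) \<partial>(lborel \<Otimes>\<^sub>M lborel))
        \<le> (\<integral>\<^sup>+p. (case p of (x, t) \<Rightarrow> ?p x t * ennreal ((cmod (f t))\<^sup>2) + ?p x t * ennreal ((cmod (g x))\<^sup>2)) \<partial>(lborel \<Otimes>\<^sub>M lborel))"
    proof (rule nn_integral_mono)
      fix p :: "real \<times> real"
      obtain x t where p: "p = (x, t)" by (cases p)
      have "0 \<le> (cmod (f t) - cmod (g x))\<^sup>2" by simp
      moreover have "0 \<le> cmod (f t) * cmod (g x)" by simp
      ultimately have "cmod (f t) * cmod (g x) \<le> (cmod (f t))\<^sup>2 + (cmod (g x))\<^sup>2"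
        unfolding power2_diff by linarith
      then have "poisson_kernel s (t - x) * (cmod (f t) * cmod (g x))
        \<le> poisson_kernel s (t - x) * ((cmod (f t))\<^sup>2 + (cmod (g x))\<^sup>2)"
        using s by (intro mult_left_mono poisson_kernel_nonneg) auto
      then show "ennreal (norm (case p of (x, t) \<Rightarrow> ?K x t))
          \<le> (case p of (x, t) \<Rightarrow> ?p x t * ennreal ((cmod (f t))\<^sup>2) + ?p x t * ennreal ((cmod (g x))\<^sup>2))"
        using s by (simp add: p norm_mult poisson_kernel_nonneg mult.assoc ennreal_mult[symmetric] ennreal_plus[symmetric] distrib_left del: ennreal_plus)
    qed
    also have "\<dots> = (\<integral>\<^sup>+p. (case p of (x, t) \<Rightarrow> ?p x t * ennreal ((cmod (f t))\<^sup>2)) \<partial>(lborel \<Otimes>\<^sub>M lborel))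
       + (\<integral>\<^sup>+p. (case p of (x, t) \<Rightarrow> ?p x t * ennreal ((cmod (g x))\<^sup>2)) \<partial>(lborel \<Otimes>\<^sub>M lborel))"
      unfolding poisson_kernel_def split_beta' by (rule nn_integral_add) measurable
    also have "(\<integral>\<^sup>+p. (case p of (x, t) \<Rightarrow> ?p x t * ennreal ((cmod (f t))\<^sup>2)) \<partial>(lborel \<Otimes>\<^sub>M lborel))
      = (\<integral>\<^sup>+t. (\<integral>\<^sup>+x. ?p x t * ennreal ((cmod (f t))\<^sup>2) \<partial>lborel) \<partial>lborel)"
      using lborel_pair.nn_integral_snd[OF mf, symmetric] by simp
    also have "\<dots> = (\<integral>\<^sup>+t. ennreal ((cmod (f t))\<^sup>2) \<partial>lborel)"
      using nn_integral_poisson_kernel[OF s] poisson_kernel_commute[of s]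
      by (simp add: nn_integral_multc)
    also have "(\<integral>\<^sup>+p. (case p of (x, t) \<Rightarrow> ?p x t * ennreal ((cmod (g x))\<^sup>2)) \<partial>(lborel \<Otimes>\<^sub>M lborel))
      = (\<integral>\<^sup>+x. (\<integral>\<^sup>+t. ?p x t * ennreal ((cmod (g x))\<^sup>2) \<partial>lborel) \<partial>lborel)"
      using lborel.nn_integral_fst[OF mg, symmetric] by simp
    also have "\<dots> = (\<integral>\<^sup>+x. ennreal ((cmod (g x))\<^sup>2) \<partial>lborel)"
      using nn_integral_poisson_kernel[OF s] by (simp add: nn_integral_multc)
    also have "(\<integral>\<^sup>+t. ennreal ((cmod (f t))\<^sup>2) \<partial>lborel) + (\<integral>\<^sup>+x. ennreal ((cmod (g x))\<^sup>2) \<partial>lborel) < \<infinity>"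
      by (simp add: square_integrable_nn_integral[OF f] square_integrable_nn_integral[OF g])
    finally show "(\<integral>\<^sup>+p. ennreal (norm (case p of (x, t) \<Rightarrow> ?K x t)) \<partial>(lborel \<Otimes>\<^sub>M lborel)) < \<infinity>" .
  qed
  from lborel_pair.Fubini_integral[OF this]
  have "(\<integral>t. (\<integral>x. ?K x t \<partial>lborel) \<partial>lborel) = (\<integral>x. (\<integral>t. ?K x t \<partial>lborel) \<partial>lborel)" .
  moreover have "(\<integral>x. ?K x t \<partial>lborel) = f t * (\<integral>x. poisson_kernel s (x - t) * g x \<partial>lborel)" for t
    by (subst integral_mult_right_zero[symmetric]) (simp add: poisson_kernel_commute[of s t] mult_ac)
  moreover have "(\<integral>t. ?K x t \<partial>lborel) = (\<integral>t. poisson_kernel s (t - x) * f t \<partial>lborel) * g x" for x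
    by (rule integral_mult_left_zero)
  ultimately show ?thesis by simp
qed

text \<open>
  If \<open>M\<close> increased from \<open>a\<close> to \<open>b\<close>, midpoint convexity would force at least the same increment on every
  later step of length \<open>b - a\<close>, and \<open>M\<close> would be unbounded.
\<close>
lemma bounded_midpoint_convex_antimono:
  fixes M :: "real \<Rightarrow> real"
  assumes conv: "\<And>y y'. 0 < y \<Longrightarrow> 0 < y' \<Longrightarrow> 2 * M ((y + y') / 2) \<le> M y + M y'"
    and bdd: "\<And>y. 0 < y \<Longrightarrow> M y \<le> C" and ab: "0 < a" "a \<le> b"
  shows "M b \<le> M a"
proof (rule ccontr)
  assume "\<not> M b \<le> M a"
  then have lt: "M a < M b" by simp
  define d where "d = b - a"
  define \<delta> where "\<delta> = M b - M a"
  have inc: "\<delta> \<le> M (b + real k * d) - M (a + real k * d)" for k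
  proof (induction k)
    case (Suc k)
    have mid: "((a + real k * d) + (b + real (Suc k) * d)) / 2 = b + real k * d"
      by (simp add: d_def field_simps)
    have "0 \<le> real k * d" "0 \<le> real (Suc k) * d" using ab by (simp_all add: d_def)
    then have "2 * M (b + real k * d) \<le> M (a + real k * d) + M (b + real (Suc k) * d)"
      using conv[of "a + real k * d" "b + real (Suc k) * d"] ab unfolding mid by linarith
    moreover have "a + real (Suc k) * d = b + real k * d" by (simp add: d_def field_simps)
    ultimately show ?case using Suc by simp
  qed (simp add: \<delta>_def)
  have grow: "M b + real k * \<delta> \<le> M (b + real k * d)" for k
  proof (induction k)
    case (Suc k)
    have eq: "a + real (Suc k) * d = b + real k * d" by (simp add: d_def field_simps)
    have "M b + real (Suc k) * \<delta> = (M b + real k * \<delta>) + \<delta>" by (simp add: algebra_simps)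
    then show ?case using Suc inc[of "Suc k"] unfolding eq by linarith
  qed simp
  obtain k where k: "(C - M b) / \<delta> < real k" using reals_Archimedean2 by blast
  then have "C - M b < real k * \<delta>" using lt by (simp add: \<delta>_def divide_less_eq)
  moreover have "0 < b + real k * d" using ab by (simp add: d_def add_pos_nonneg)
  ultimately show False using grow[of k] bdd[of "b + real k * d"] by simp
qed

text \<open>
  The Poisson formula moves a height \<open>s\<close> from one slice to the other: the inner product of the slices at
  \<open>y + 2 s\<close> and \<open>y\<close> equals the squared norm of the slice at \<open>y + s\<close>.  So the inner product of two slices is
  the squared norm at the mean height.
\<close>
lemma hardy2_slices_diff:
  assumes f: "f \<in> hardy2" and y: "0 < y" "0 < y'"
  shows "(norm_L2 (\<lambda>x. slice f y x - slice f y' x))\<^sup>2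
       = (norm_L2 (slice f y))\<^sup>2 + (norm_L2 (slice f y'))\<^sup>2 - 2 * (norm_L2 (slice f ((y + y') / 2)))\<^sup>2"
proof -
  have sq: "square_integrable (slice f y)" if "0 < y" for y
    using hardy2_slices[OF f] that by blast
  have step: "(\<integral>x. slice f (y + 2 * s) x * cnj (slice f y x) \<partial>lborel)
      = (\<integral>x. slice f (y + s) x * cnj (slice f (y + s) x) \<partial>lborel)" if y: "0 < y" and s: "0 < s" for y s
  proof -
    have "slice f (y + 2 * s) x = (\<integral>t. poisson_kernel s (t - x) * slice f (y + s) t \<partial>lborel)" for x
      using hardy2_poisson_formula[OF f, of "y + s" s x] y s by (simp add: slice_def add.assoc)
    moreover have "cnj (slice f (y + s) x) = (\<integral>t. poisson_kernel s (t - x) * cnj (slice f y t) \<partial>lborel)" for x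
    proof -
      have "cnj (slice f (y + s) x) = (\<integral>t. cnj (poisson_kernel s (t - x) * slice f y t) \<partial>lborel)"
        using hardy2_poisson_formula[OF f y s, of x] unfolding Bochner_Integration.integral_cnj
        by (simp add: slice_def)
      also have "(\<lambda>t. cnj (poisson_kernel s (t - x) * slice f y t)) = (\<lambda>t. poisson_kernel s (t - x) * cnj (slice f y t))"
        by simp
      finally show ?thesis .
    qed
    ultimately show ?thesis
      using poisson_convolution_symmetric[OF sq square_integrable_cnj(1)[OF sq], of "y + s" y s] y s by simp
  qed
  have norm: "(\<integral>x. g x * cnj (g x) \<partial>lborel) = complex_of_real ((norm_L2 g)\<^sup>2)" for g
    unfolding norm_L2_power2 complex_norm_square[symmetric] by (rule integral_complex_of_real)
  have inner: "(\<integral>x. slice f y x * cnj (slice f y' x) \<partial>lborel) = complex_of_real ((norm_L2 (slice f ((y + y') / 2)))\<^sup>2)"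
    if y: "0 < y'" "y' \<le> y" for y y'
  proof (cases "y' = y")
    case False
    then show ?thesis
      using step[of y' "(y - y') / 2"] y norm[of "slice f ((y + y') / 2)"]
      by (simp add: field_simps)
  qed (simp add: norm)
  have "Re (\<integral>x. slice f y x * cnj (slice f y' x) \<partial>lborel) = (norm_L2 (slice f ((y + y') / 2)))\<^sup>2"
  proof (cases "y' \<le> y")
    case False
    then have "(\<integral>x. cnj (slice f y' x * cnj (slice f y x)) \<partial>lborel) = complex_of_real ((norm_L2 (slice f ((y + y') / 2)))\<^sup>2)"
      unfolding Bochner_Integration.integral_cnj using inner[of y y'] y by (simp add: add.commute)
    then show ?thesis by (simp add: mult.commute)
  qed (use inner[of y' y] y in simp)
  then show ?thesis
    using norm_L2_diff_expand(2)[OF sq sq, of y y'] y by simp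
qed

text \<open>
  By the previous identity the squared norm \<open>M\<close> of the slices is midpoint convex in the height; being
  bounded, it is decreasing and converges at \<open>0\<close>.  The squared distance
  \<open>M y + M y' - 2 M ((y + y') / 2)\<close> is then small for all small heights.
\<close>
lemma hardy2_slices_Cauchy:
  assumes f: "f \<in> hardy2" and e: "0 < e"
  obtains d where "0 < d"
    "\<And>y y'. 0 < y \<Longrightarrow> y \<le> d \<Longrightarrow> 0 < y' \<Longrightarrow> y' \<le> d \<Longrightarrow> (norm_L2 (\<lambda>x. slice f y x - slice f y' x))\<^sup>2 \<le> e"
proof -
  obtain E where E: "0 \<le> E" "\<And>y. 0 < y \<Longrightarrow> square_integrable (slice f y)"
    "\<And>y. 0 < y \<Longrightarrow> norm_L2 (slice f y) \<le> E" using hardy2_slices[OF f] by blast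
  define M where "M y = (norm_L2 (slice f y))\<^sup>2" for y
  have diff: "(norm_L2 (\<lambda>x. slice f y x - slice f y' x))\<^sup>2 = M y + M y' - 2 * M ((y + y') / 2)"
    if "0 < y" "0 < y'" for y y'
    unfolding M_def by (rule hardy2_slices_diff[OF f that])
  have bdd: "M y \<le> E\<^sup>2" if "0 < y" for y
    unfolding M_def using E(3)[OF that] norm_L2_nonneg by (rule power_mono)
  have anti: "M b \<le> M a" if "0 < a" "a \<le> b" for a b
  proof (rule bounded_midpoint_convex_antimono[OF _ bdd that])
    fix y y' :: real assume "0 < y" "0 < y'"
    from diff[OF this] show "2 * M ((y + y') / 2) \<le> M y + M y'"
      by (metis diff_ge_0_iff_ge zero_le_power2)
  qed
  define L where "L = (SUP y\<in>{0<..}. M y)"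
  have bA: "bdd_above (M ` {0<..})" using bdd by (auto intro!: bdd_aboveI2)
  have "\<exists>d\<in>{0<..}. L - e / 2 < M d"
    unfolding L_def by (subst less_cSUP_iff[OF _ bA, symmetric]) (use e in auto)
  then obtain d where d: "0 < d" "L - e / 2 < M d" by auto
  show ?thesis
  proof (rule that[OF d(1)])
    fix y y' assume y: "0 < y" "y \<le> d" "0 < y'" "y' \<le> d"
    have "M y \<le> L" "M y' \<le> L" unfolding L_def using y by (auto intro!: cSUP_upper bA)
    moreover have "M d \<le> M ((y + y') / 2)" using y by (intro anti) auto
    ultimately show "(norm_L2 (\<lambda>x. slice f y x - slice f y' x))\<^sup>2 \<le> e"
      using diff[of y y'] y d by simp
  qed
qed

text \<open>
  Completeness of \<open>L\<^sup>2\<close> for a sequence with geometrically small distances.  The weighted series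
  \<open>\<Sum>n. 2\<^sup>n \<bar>X\<^sub>n - X\<^sub>n\<^sub>+\<^sub>1\<bar>\<^sup>2\<close> has finite integral, hence is finite almost everywhere, which forces pointwise
  convergence; Fatou's lemma then transfers the distance bounds to the limit.
\<close>
lemma square_integrable_fast_Cauchy_limit:
  fixes X :: "nat \<Rightarrow> real \<Rightarrow> complex"
  assumes X: "\<And>n. square_integrable (X n)"
    and close: "\<And>m n. n \<le> m \<Longrightarrow> (norm_L2 (\<lambda>x. X n x - X m x))\<^sup>2 \<le> (1/4) ^ n"
  obtains b where "square_integrable b" "(\<lambda>n. norm_L2 (\<lambda>x. X n x - b x)) \<longlonglongrightarrow> 0"
proof -
  note [measurable] = square_integrableD(2)[OF X]
  have diff: "square_integrable (\<lambda>x. X n x - X m x)" for m n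
    using norm_L2_diff_expand(1)[OF X X] .
  have nn: "(\<integral>\<^sup>+x. ennreal ((cmod (X n x - X m x))\<^sup>2) \<partial>lborel) \<le> ennreal ((1/4) ^ n)" if "n \<le> m" for m n
    unfolding square_integrable_nn_integral[OF diff] using close[OF that] by (rule ennreal_leI)
  have "(\<integral>\<^sup>+x. (\<Sum>n. ennreal (2 ^ n * (cmod (X n x - X (Suc n) x))\<^sup>2)) \<partial>lborel)
      = (\<Sum>n. \<integral>\<^sup>+x. ennreal (2 ^ n * (cmod (X n x - X (Suc n) x))\<^sup>2) \<partial>lborel)"
    by (rule nn_integral_suminf) measurable
  also have "\<dots> \<le> (\<Sum>n. ennreal ((1/2) ^ n))"
  proof (intro suminf_le allI)
    fix n
    have "(\<integral>\<^sup>+x. ennreal (2 ^ n * (cmod (X n x - X (Suc n) x))\<^sup>2) \<partial>lborel)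
      = (\<integral>\<^sup>+x. ennreal (2 ^ n) * ennreal ((cmod (X n x - X (Suc n) x))\<^sup>2) \<partial>lborel)"
      by (intro nn_integral_cong ennreal_mult) auto
    also have "\<dots> = ennreal (2 ^ n) * (\<integral>\<^sup>+x. ennreal ((cmod (X n x - X (Suc n) x))\<^sup>2) \<partial>lborel)"
      by (rule nn_integral_cmult) measurable
    also have "\<dots> \<le> ennreal (2 ^ n) * ennreal ((1/4) ^ n)"
      using nn[of n "Suc n"] by (intro mult_left_mono) auto
    also have "\<dots> = ennreal ((2 * (1/4)) ^ n)"
      unfolding power_mult_distrib by (rule ennreal_mult[symmetric]) auto
    also have "\<dots> = ennreal ((1/2) ^ n)" by simp
    finally show "(\<integral>\<^sup>+x. ennreal (2 ^ n * (cmod (X n x - X (Suc n) x))\<^sup>2) \<partial>lborel) \<le> ennreal ((1/2) ^ n)" .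
  qed auto
  also have "\<dots> = ennreal (\<Sum>n. (1/2) ^ n)"
    by (rule suminf_ennreal2) (simp, rule summable_geometric, simp)
  also have "\<dots> < \<infinity>" unfolding infinity_ennreal_def by (rule ennreal_less_top)
  finally have "(\<integral>\<^sup>+x. (\<Sum>n. ennreal (2 ^ n * (cmod (X n x - X (Suc n) x))\<^sup>2)) \<partial>lborel) < \<infinity>" .
  then have "AE x in lborel. (\<Sum>n. ennreal (2 ^ n * (cmod (X n x - X (Suc n) x))\<^sup>2)) \<noteq> \<infinity>"
    by (intro nn_integral_PInf_AE borel_measurable_suminf_order less_imp_neq) measurable
  then have conv: "AE x in lborel. convergent (\<lambda>n. X n x)"
  proof eventually_elim
    case (elim x)
    define a where "a n = cmod (X n x - X (Suc n) x)" for n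
    have "summable (\<lambda>n. 2 ^ n * (a n)\<^sup>2)"
      using elim by (intro summable_suminf_not_top) (auto simp: a_def)
    then have s: "summable (\<lambda>n. (1/2) ^ n + 2 ^ n * (a n)\<^sup>2)"
      by (intro summable_add summable_geometric) simp
    \<comment> \<open>Either \<open>a\<^sub>n \<le> 2\<^sup>-\<^sup>n\<close>, or \<open>2\<^sup>n a\<^sub>n > 1\<close> and then \<open>a\<^sub>n \<le> 2\<^sup>n a\<^sub>n\<^sup>2\<close>.\<close>
    have "a n \<le> (1/2) ^ n + 2 ^ n * (a n)\<^sup>2" for n
    proof (cases "a n \<le> (1/2) ^ n")
      case False
      then have "2 ^ n * (1/2) ^ n \<le> 2 ^ n * a n" by (intro mult_left_mono) auto
      then have "1 \<le> 2 ^ n * a n" by (simp add: power_one_over)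
      then have "1 * a n \<le> (2 ^ n * a n) * a n" by (rule mult_right_mono) (simp add: a_def)
      moreover have "0 \<le> (1/2 :: real) ^ n" by simp
      ultimately show ?thesis unfolding power2_eq_square by linarith
    next
      case True
      moreover have "0 \<le> 2 ^ n * (a n)\<^sup>2" by simp
      ultimately show ?thesis by linarith
    qed
    then have "summable (\<lambda>n. norm (X (Suc n) x - X n x))"
      by (intro summable_comparison_test_ev[OF _ s] always_eventually) (auto simp: a_def norm_minus_commute)
    then have "summable (\<lambda>n. X (Suc n) x - X n x)" by (rule summable_norm_cancel)
    then have "convergent (\<lambda>n. \<Sum>k<n. X (Suc k) x - X k x)" by (simp add: summable_iff_convergent)
    then have "convergent (\<lambda>n. X n x - X 0 x)" by (simp only: sum_lessThan_telescope[of "\<lambda>n. X n x"])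
    then show ?case by (simp add: convergent_diff_const_right_iff)
  qed
  define b where "b x = lim (\<lambda>n. X n x)" for x
  have [measurable]: "b \<in> borel_measurable borel"
    unfolding b_def[abs_def] by (rule borel_measurable_lim_metric) simp
  have lim: "AE x in lborel. (\<lambda>n. X n x) \<longlonglongrightarrow> b x"
    using conv unfolding b_def by eventually_elim (rule convergent_LIMSEQ_iff[THEN iffD1])
  have nnb: "(\<integral>\<^sup>+x. ennreal ((cmod (X n x - b x))\<^sup>2) \<partial>lborel) \<le> ennreal ((1/4) ^ n)" for n
  proof -
    have "(\<integral>\<^sup>+x. ennreal ((cmod (X n x - b x))\<^sup>2) \<partial>lborel)
      = (\<integral>\<^sup>+x. liminf (\<lambda>m. ennreal ((cmod (X n x - X m x))\<^sup>2)) \<partial>lborel)"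
    proof (rule nn_integral_cong_AE, use lim in eventually_elim)
      case (elim x)
      then have "(\<lambda>m. ennreal ((cmod (X n x - X m x))\<^sup>2)) \<longlonglongrightarrow> ennreal ((cmod (X n x - b x))\<^sup>2)"
        by (intro tendsto_ennrealI tendsto_intros)
      then show ?case by (rule lim_imp_Liminf[OF sequentially_bot, symmetric])
    qed
    also have "\<dots> \<le> liminf (\<lambda>m. \<integral>\<^sup>+x. ennreal ((cmod (X n x - X m x))\<^sup>2) \<partial>lborel)"
      by (rule nn_integral_liminf) measurable
    also have "\<dots> \<le> liminf (\<lambda>m::nat. ennreal ((1/4) ^ n))"
    proof (rule Liminf_mono)
      show "\<forall>\<^sub>F m in sequentially. (\<integral>\<^sup>+x. ennreal ((cmod (X n x - X m x))\<^sup>2) \<partial>lborel) \<le> ennreal ((1/4) ^ n)"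
        using eventually_ge_at_top[of n] by eventually_elim (rule nn)
    qed
    also have "\<dots> = ennreal ((1/4) ^ n)" by (rule Liminf_const) simp
    finally show ?thesis .
  qed
  have sq: "square_integrable (\<lambda>x. X n x - b x)" "(norm_L2 (\<lambda>x. X n x - b x))\<^sup>2 \<le> (1/4) ^ n" for n
    using square_integrableI_bounded[OF _ nnb[of n]] by auto
  show ?thesis
  proof (rule that)
    have "square_integrable (\<lambda>x. X 0 x - (X 0 x - b x))"
      by (rule norm_L2_diff_expand(1)[OF X sq(1)])
    then show "square_integrable b" by simp
    show "(\<lambda>n. norm_L2 (\<lambda>x. X n x - b x)) \<longlonglongrightarrow> 0"
    proof (rule Lim_null_comparison)
      show "(\<lambda>n. (1/2 :: real) ^ n) \<longlonglongrightarrow> 0" by (rule LIMSEQ_realpow_zero) auto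
      show "\<forall>\<^sub>F n in sequentially. norm (norm_L2 (\<lambda>x. X n x - b x)) \<le> (1/2) ^ n"
      proof (rule always_eventually, rule allI)
        fix n
        have "(1/4 :: real) ^ n = ((1/2) * (1/2)) ^ n" by simp
        then have "(norm_L2 (\<lambda>x. X n x - b x))\<^sup>2 \<le> ((1/2) ^ n)\<^sup>2"
          using sq(2)[of n] unfolding power_mult_distrib power2_eq_square by simp
        then have "norm_L2 (\<lambda>x. X n x - b x) \<le> (1/2) ^ n"
          by (rule power2_le_imp_le) simp
        then show "norm (norm_L2 (\<lambda>x. X n x - b x)) \<le> (1/2) ^ n"
          using norm_L2_nonneg[of "\<lambda>x. X n x - b x"] by simp
      qed
    qed
  qed
qed

text \<open>
  The density \<open>b\<close> is the limit in \<open>L\<^sup>2\<close> of slices at heights tending to \<open>0\<close>; the Poisson formulas above these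
  heights pass to the limit since the kernel is square integrable.
\<close>
lemma hardy2_poisson_representation:
  assumes f: "f \<in> hardy2"
  obtains b :: "real \<Rightarrow> complex" where "square_integrable b"
    "\<And>x y. 0 < y \<Longrightarrow> f (Complex x y) = (\<integral>t. poisson_kernel y (t - x) * b t \<partial>lborel)"
proof -
  have sq: "square_integrable (slice f y)" if "0 < y" for y
    using hardy2_slices[OF f] that by blast
  have "\<exists>d>0. \<forall>y y'. 0 < y \<longrightarrow> y \<le> d \<longrightarrow> 0 < y' \<longrightarrow> y' \<le> d \<longrightarrow>
      (norm_L2 (\<lambda>x. slice f y x - slice f y' x))\<^sup>2 \<le> (1/4) ^ n" for n :: nat
    by (rule hardy2_slices_Cauchy[OF f, of "(1/4) ^ n"]) auto
  then obtain d where d: "\<And>n. 0 < d n"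
    "\<And>n y y'. 0 < y \<Longrightarrow> y \<le> d n \<Longrightarrow> 0 < y' \<Longrightarrow> y' \<le> d n \<Longrightarrow>
      (norm_L2 (\<lambda>x. slice f y x - slice f y' x))\<^sup>2 \<le> (1/4) ^ n" for n :: nat
    by metis
  \<comment> \<open>The minimum over all earlier thresholds keeps every later height below \<open>d n\<close>.\<close>
  define Y where "Y n = min (1 / (real n + 1)) (Min (d ` {..n}))" for n
  have Y0: "0 < Y n" for n using d(1) by (simp add: Y_def)
  have Yd: "Y m \<le> d n" if "n \<le> m" for m n
    unfolding Y_def using that by (intro min.coboundedI2 Min_le) auto
  have Ylim: "Y \<longlonglongrightarrow> 0"
  proof (rule Lim_null_comparison)
    show "(\<lambda>n. 1 / (real n + 1)) \<longlonglongrightarrow> 0" by real_asymp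
    show "\<forall>\<^sub>F n in sequentially. norm (Y n) \<le> 1 / (real n + 1)"
      using Y0 by (intro always_eventually) (auto simp: less_imp_le, simp add: Y_def)
  qed
  have "(norm_L2 (\<lambda>x. slice f (Y n) x - slice f (Y m) x))\<^sup>2 \<le> (1/4) ^ n" if "n \<le> m" for m n
    by (rule d(2)) (use Y0 Yd that in auto)
  then obtain b where b: "square_integrable b" and
    lim: "(\<lambda>n. norm_L2 (\<lambda>x. slice f (Y n) x - b x)) \<longlonglongrightarrow> 0"
    using square_integrable_fast_Cauchy_limit[of "\<lambda>n. slice f (Y n)"] sq[OF Y0] by blast
  show ?thesis
  proof (rule that[OF b])
    fix x y :: real assume y: "0 < y"
    let ?P = "\<lambda>t. complex_of_real (poisson_kernel y (t - x))"
    have P: "square_integrable ?P" by (rule poisson_kernel_square_integrable[OF y])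
    have "(\<lambda>n. f (Complex x (Y n + y))) \<longlonglongrightarrow> f (Complex x (0 + y))"
    proof (rule continuous_on_tendsto_compose[OF holomorphic_on_imp_continuous_on[OF hardy2_holomorphic[OF f]]])
      show "(\<lambda>n. Complex x (Y n + y)) \<longlonglongrightarrow> Complex x (0 + y)"
        by (intro tendsto_Complex tendsto_intros Ylim)
    qed (use y Y0 in \<open>auto simp: add_pos_pos intro!: always_eventually\<close>)
    moreover have "(\<lambda>n. f (Complex x (Y n + y))) \<longlonglongrightarrow> (\<integral>t. ?P t * b t \<partial>lborel)"
    proof (rule Lim_transform2[OF tendsto_const], rule Lim_null_comparison)
      show "(\<lambda>n. norm_L2 ?P * norm_L2 (\<lambda>x. slice f (Y n) x - b x)) \<longlonglongrightarrow> 0"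
        using tendsto_mult_right_zero[OF lim] .
      show "\<forall>\<^sub>F n in sequentially. norm ((\<integral>t. ?P t * b t \<partial>lborel) - f (Complex x (Y n + y)))
         \<le> norm_L2 ?P * norm_L2 (\<lambda>x. slice f (Y n) x - b x)"
      proof (rule always_eventually, rule allI)
        fix n
        have "f (Complex x (Y n + y)) - (\<integral>t. ?P t * b t \<partial>lborel) = (\<integral>t. ?P t * (slice f (Y n) t - b t) \<partial>lborel)"
          unfolding hardy2_poisson_formula[OF f Y0 y] right_diff_distrib
          by (rule Bochner_Integration.integral_diff[symmetric]) (intro square_integrable_mult(1) P b sq Y0)+
        then show "norm ((\<integral>t. ?P t * b t \<partial>lborel) - f (Complex x (Y n + y)))
         \<le> norm_L2 ?P * norm_L2 (\<lambda>x. slice f (Y n) x - b x)"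
          using square_integrable_mult(3)[OF P norm_L2_diff_expand(1)[OF sq[OF Y0] b], of n]
          by (simp add: norm_minus_commute)
      qed
    qed
    ultimately show "f (Complex x y) = (\<integral>t. ?P t * b t \<partial>lborel)"
      using LIMSEQ_unique by fastforce
  qed
qed

section \<open>Vertical limits of Poisson integrals\<close>

text \<open>
  The Poisson kernel as a mixture of indicator functions of centred intervals, with density
  \<open>- \<partial>P\<^sub>y(r)/\<partial>r\<close>.
\<close>
lemma poisson_kernel_layer_cake:
  assumes y: "0 < y"
  shows "(\<integral>\<^sup>+r. ennreal (2 * y * r / (pi * (r\<^sup>2 + y\<^sup>2)\<^sup>2)) * indicator {\<bar>s\<bar>..} r \<partial>lborel)
       = ennreal (poisson_kernel y s)"
proof -
  have pos: "0 < r\<^sup>2 + y\<^sup>2" for r using y by (simp add: add_nonneg_pos)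
  have "(\<integral>\<^sup>+r. ennreal (2 * y * r / (pi * (r\<^sup>2 + y\<^sup>2)\<^sup>2)) * indicator {\<bar>s\<bar>..} r \<partial>lborel)
    = ennreal (0 - (- y / (pi * (\<bar>s\<bar>\<^sup>2 + y\<^sup>2))))"
  proof (rule nn_integral_FTC_atLeast)
    show "((\<lambda>r. - y / (pi * (r\<^sup>2 + y\<^sup>2))) has_real_derivative 2 * y * r / (pi * (r\<^sup>2 + y\<^sup>2)\<^sup>2)) (at r)" for r
    proof -
      have "y * (2 * r) / (A * (pi * A)) = 2 * y * r / (pi * A\<^sup>2)" for A
        by (simp add: power2_eq_square mult_ac)
      from this[of "r\<^sup>2 + y\<^sup>2"] show ?thesis
        using pos[of r] by (auto intro!: derivative_eq_intros)
    qed
    show "((\<lambda>r. - y / (pi * (r\<^sup>2 + y\<^sup>2))) \<longlongrightarrow> 0) at_top" using y by real_asymp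
  qed (use y in \<open>auto intro!: divide_nonneg_nonneg mult_nonneg_nonneg\<close>)
  also have "\<dots> = ennreal (poisson_kernel y s)" by (simp add: poisson_kernel_def)
  finally show ?thesis .
qed

text \<open>
  Writing the kernel as a mixture of centred intervals turns the local Poisson integral into an average of
  \<open>e\<close> over intervals of radius at most \<open>\<delta>\<close>, each controlled by the hypothesis.
\<close>
lemma poisson_local_average:
  fixes e :: "real \<Rightarrow> complex"
  assumes y: "0 < y" and \<delta>: "0 < \<delta>" and \<epsilon>: "0 \<le> \<epsilon>"
    and i: "set_integrable lborel {x - \<delta>..x + \<delta>} e"
    and avg: "\<And>r. 0 < r \<Longrightarrow> r \<le> \<delta> \<Longrightarrow> cmod (LINT t:{x - r..x + r}|lborel. e t) \<le> 2 * \<epsilon> * r"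
  shows "cmod (LINT t:{x - \<delta>..x + \<delta>}|lborel. poisson_kernel y (t - x) * e t) \<le> \<epsilon>"
proof -
  define k where "k t = indicator {x - \<delta>..x + \<delta>} t *\<^sub>R e t" for t
  define q where "q r = indicator {0..} r * (2 * y * r / (pi * (r\<^sup>2 + y\<^sup>2)\<^sup>2))" for r :: real
  have ik: "integrable lborel k" using i by (simp add: k_def[abs_def] set_integrable_def)
  then have [measurable]: "k \<in> borel_measurable borel" by auto
  have [measurable]: "q \<in> borel_measurable borel" unfolding q_def[abs_def] by measurable
  have q0: "0 \<le> q r" for r using y by (simp add: q_def indicator_def)
  have cake: "(\<integral>\<^sup>+r. ennreal (q r) * indicator {\<bar>s\<bar>..} r \<partial>lborel) = ennreal (poisson_kernel y s)" for s
    unfolding poisson_kernel_layer_cake[OF y, symmetric]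
    by (rule nn_integral_cong) (auto simp: q_def indicator_def)
  \<comment> \<open>The joint kernel: \<open>H t r\<close> integrates over \<open>r\<close> to the Poisson kernel at \<open>t - x\<close>.\<close>
  define H where "H t r = q r * indicator {\<bar>t - x\<bar>..} r" for t r :: real
  have H0: "0 \<le> H t r" for t r by (simp add: H_def q0)
  have mH[measurable]: "(\<lambda>(t, r). H t r) \<in> borel_measurable (lborel \<Otimes>\<^sub>M lborel)"
    unfolding H_def indicator_def atLeast_iff split_beta' by measurable
  have nnH: "(\<integral>\<^sup>+r. ennreal (H t r) \<partial>lborel) = ennreal (poisson_kernel y (t - x))" for t
    unfolding cake[symmetric] H_def by (rule nn_integral_cong) (auto simp: indicator_def)
  have hbH: "has_bochner_integral lborel (\<lambda>r. H t r) (poisson_kernel y (t - x))" for t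
  proof (rule has_bochner_integral_nn_integral)
    show "(\<lambda>r. H t r) \<in> borel_measurable lborel" unfolding H_def by measurable
  qed (use y in \<open>auto simp: nnH H0 poisson_kernel_nonneg\<close>)
  have iHk: "integrable (lborel \<Otimes>\<^sub>M lborel) (\<lambda>(t, r). complex_of_real (H t r) * k t)"
  proof (rule integrableI_bounded)
    show m: "(\<lambda>(t, r). complex_of_real (H t r) * k t) \<in> borel_measurable (lborel \<Otimes>\<^sub>M lborel)"
      using mH unfolding split_beta' by measurable
    have "(\<integral>\<^sup>+p. ennreal (norm (case p of (t, r) \<Rightarrow> complex_of_real (H t r) * k t)) \<partial>(lborel \<Otimes>\<^sub>M lborel))
      = (\<integral>\<^sup>+t. \<integral>\<^sup>+r. ennreal (norm (complex_of_real (H t r) * k t)) \<partial>lborel \<partial>lborel)"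
      using m by (subst lborel.nn_integral_fst[symmetric]) auto
    also have "\<dots> = (\<integral>\<^sup>+t. ennreal (poisson_kernel y (t - x)) * ennreal (norm (k t)) \<partial>lborel)"
    proof (rule nn_integral_cong)
      fix t
      have "(\<integral>\<^sup>+r. ennreal (norm (complex_of_real (H t r) * k t)) \<partial>lborel)
         = (\<integral>\<^sup>+r. ennreal (H t r) * ennreal (norm (k t)) \<partial>lborel)"
        by (rule nn_integral_cong) (simp add: norm_mult H0 ennreal_mult)
      also have "\<dots> = (\<integral>\<^sup>+r. ennreal (H t r) \<partial>lborel) * ennreal (norm (k t))"
        by (rule nn_integral_multc) (simp add: H_def)
      finally show "(\<integral>\<^sup>+r. ennreal (norm (complex_of_real (H t r) * k t)) \<partial>lborel)
         = ennreal (poisson_kernel y (t - x)) * ennreal (norm (k t))" by (simp add: nnH)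
    qed
    also have "\<dots> \<le> (\<integral>\<^sup>+t. ennreal (1 / (pi * y)) * ennreal (norm (k t)) \<partial>lborel)"
      by (intro nn_integral_mono mult_right_mono ennreal_leI poisson_kernel_le[OF y]) auto
    also have "\<dots> = ennreal (1 / (pi * y)) * (\<integral>\<^sup>+t. ennreal (norm (k t)) \<partial>lborel)"
      by (rule nn_integral_cmult) simp
    also have "\<dots> < \<infinity>"
      using ik by (simp add: integrable_iff_bounded ennreal_mult_less_top)
    finally show "(\<integral>\<^sup>+p. ennreal (norm (case p of (t, r) \<Rightarrow> complex_of_real (H t r) * k t)) \<partial>(lborel \<Otimes>\<^sub>M lborel)) < \<infinity>" .
  qed
  \<comment> \<open>The interval of radius \<open>r\<close> has length \<open>2 r\<close>, so this is the mass of the Poisson kernel, by Tonelli.\<close>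
  have mass: "has_bochner_integral lborel (\<lambda>r. 2 * r * q r) 1"
  proof (rule has_bochner_integral_nn_integral)
    have "(\<integral>\<^sup>+r. ennreal (2 * r * q r) \<partial>lborel) = (\<integral>\<^sup>+r. \<integral>\<^sup>+t. ennreal (H t r) \<partial>lborel \<partial>lborel)"
    proof (rule nn_integral_cong)
      fix r :: real
      have "(\<integral>\<^sup>+t. ennreal (H t r) \<partial>lborel) = (\<integral>\<^sup>+t. ennreal (q r) * indicator {x - r..x + r} t \<partial>lborel)"
        by (rule nn_integral_cong) (auto simp: H_def indicator_def abs_le_iff)
      also have "\<dots> = ennreal (q r) * emeasure lborel {x - r..x + r}"
        by (rule nn_integral_cmult_indicator) simp
      also have "\<dots> = ennreal (2 * r * q r)"
        using q0[of r] by (cases "0 \<le> r") (auto simp: ennreal_mult[symmetric] mult_ac, simp_all add: q_def)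
      finally show "ennreal (2 * r * q r) = (\<integral>\<^sup>+t. ennreal (H t r) \<partial>lborel)" by simp
    qed
    also have "\<dots> = (\<integral>\<^sup>+t. \<integral>\<^sup>+r. ennreal (H t r) \<partial>lborel \<partial>lborel)"
      using lborel_pair.Fubini'[of "\<lambda>t r. ennreal (H t r)"] mH by simp
    also have "\<dots> = 1" unfolding nnH by (rule nn_integral_poisson_kernel[OF y])
    finally show "(\<integral>\<^sup>+r. ennreal (2 * r * q r) \<partial>lborel) = ennreal 1" by simp
    show "AE r in lborel. 0 \<le> 2 * r * q r"
    proof (rule AE_I2)
      fix r :: real
      show "0 \<le> 2 * r * q r"
      proof (cases "0 \<le> r")
        case True
        then show ?thesis using q0[of r] by (intro mult_nonneg_nonneg) auto
      qed (simp add: q_def)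
    qed
  qed auto
  have inner: "cmod (\<integral>t. complex_of_real (H t r) * k t \<partial>lborel) \<le> \<epsilon> * (2 * r * q r)" for r
  proof -
    have eq: "complex_of_real (H t r) * k t = q r * (indicator {x - min r \<delta>..x + min r \<delta>} t *\<^sub>R e t)" for t
      by (auto simp: H_def k_def indicator_def abs_le_iff)
    have "cmod (\<integral>t. complex_of_real (H t r) * k t \<partial>lborel)
       = q r * cmod (LINT t:{x - min r \<delta>..x + min r \<delta>}|lborel. e t)"
      unfolding eq set_lebesgue_integral_def integral_mult_right_zero norm_mult using q0 by simp
    also have "\<dots> \<le> q r * (2 * \<epsilon> * r)"
    proof (cases "0 < r")
      case True
      have "cmod (LINT t:{x - min r \<delta>..x + min r \<delta>}|lborel. e t) \<le> 2 * \<epsilon> * min r \<delta>"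
        by (rule avg) (use True \<delta> in auto)
      also have "\<dots> \<le> 2 * \<epsilon> * r" using \<epsilon> by (intro mult_left_mono) auto
      finally show ?thesis by (rule mult_left_mono) (rule q0)
    qed (auto simp: q_def indicator_def)
    finally show ?thesis by (simp add: mult_ac)
  qed
  have "(LINT t:{x - \<delta>..x + \<delta>}|lborel. poisson_kernel y (t - x) * e t)
     = (\<integral>t. complex_of_real (poisson_kernel y (t - x)) * k t \<partial>lborel)"
    unfolding set_lebesgue_integral_def k_def by (rule Bochner_Integration.integral_cong) auto
  also have "\<dots> = (\<integral>t. (\<integral>r. complex_of_real (H t r) * k t \<partial>lborel) \<partial>lborel)"
    using hbH by (simp add: has_bochner_integral_iff)
  also have "\<dots> = (\<integral>r. (\<integral>t. complex_of_real (H t r) * k t \<partial>lborel) \<partial>lborel)"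
    by (rule lborel_pair.Fubini_integral[OF iHk, symmetric])
  also have "cmod \<dots> \<le> (\<integral>r. \<epsilon> * (2 * r * q r) \<partial>lborel)"
  proof (rule Bochner_Integration.integral_norm_bound_integral)
    show "integrable lborel (\<lambda>r. \<integral>t. complex_of_real (H t r) * k t \<partial>lborel)"
      using lborel_pair.integrable_snd[OF iHk] by simp
    show "integrable lborel (\<lambda>r. \<epsilon> * (2 * r * q r))"
      using mass by (intro integrable_mult_right) (auto simp: has_bochner_integral_iff)
  qed (use inner in auto)
  also have "\<dots> = \<epsilon>" using mass by (simp add: has_bochner_integral_iff)
  finally show ?thesis .
qed

text \<open>
  The Lebesgue differentiation theorem, for intervals to the right of the point.
\<close>
lemma right_averages_AE:
  fixes b :: "real \<Rightarrow> complex"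
  assumes b: "square_integrable b"
  shows "AE x in lborel. \<forall>e>0. \<exists>d>0. \<forall>r. 0 < r \<and> r < d \<longrightarrow>
     cmod ((LINT t:{x..x + r}|lborel. b t) - of_real r * b x) \<le> e * r"
proof -
  have int: "b integrable_on {l..u}" "(LINT t:{l..u}|lborel. b t) = integral {l..u} b" for l u
    using set_borel_integral_eq_integral[OF square_integrable_set_integrable[OF b]] by blast+
  then have "b integrable_on cbox l u" for l u by simp
  from integrable_ccontinuous_explicit[OF this]
  obtain N where N: "negligible N"
    "\<And>x e. x \<notin> N \<Longrightarrow> 0 < e \<Longrightarrow> \<exists>d>0. \<forall>h. 0 < h \<and> h < d \<longrightarrow>
       norm (integral (cbox x (x + h *\<^sub>R One)) b /\<^sub>R h ^ DIM(real) - b x) < e"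
    by blast
  have "AE x in lebesgue. x \<notin> N"
    using N(1) by (simp add: negligible_iff_null_sets AE_not_in)
  then have "AE x in lborel. x \<notin> N" by (simp add: AE_completion_iff)
  then show ?thesis
  proof eventually_elim
    case (elim x)
    show ?case
    proof (intro allI impI)
      fix e :: real assume "0 < e"
      from N(2)[OF elim this] obtain d where d: "0 < d"
        "\<And>h. 0 < h \<Longrightarrow> h < d \<Longrightarrow> norm (integral {x..x + h} b /\<^sub>R h - b x) < e" by auto
      show "\<exists>d>0. \<forall>r. 0 < r \<and> r < d \<longrightarrow>
         cmod ((LINT t:{x..x + r}|lborel. b t) - of_real r * b x) \<le> e * r"
      proof (intro exI conjI allI impI)
        fix r assume r: "0 < r \<and> r < d"
        have "(LINT t:{x..x + r}|lborel. b t) - of_real r * b x = r *\<^sub>R (integral {x..x + r} b /\<^sub>R r - b x)"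
          using r by (simp add: int(2) scaleR_diff_right) (simp add: scaleR_conv_of_real)
        then show "cmod ((LINT t:{x..x + r}|lborel. b t) - of_real r * b x) \<le> e * r"
          using d(2)[of r] r by (simp add: mult.commute)
      qed (rule d(1))
    qed
  qed
qed

text \<open>
  The reflection \<open>t \<mapsto> - t\<close> preserves Lebesgue measure and exchanges left and right intervals.
\<close>
lemma left_averages_AE:
  fixes b :: "real \<Rightarrow> complex"
  assumes b: "square_integrable b"
  shows "AE x in lborel. \<forall>e>0. \<exists>d>0. \<forall>r. 0 < r \<and> r < d \<longrightarrow>
     cmod ((LINT t:{x - r..x}|lborel. b t) - of_real r * b x) \<le> e * r"
proof -
  define c where "c t = b (- t)" for t
  have "square_integrable c"
    unfolding square_integrable_def
  proof
    show "c \<in> borel_measurable lborel"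
      unfolding c_def[abs_def] using square_integrableD(2)[OF b] by measurable
    show "integrable lborel (\<lambda>x. (cmod (c x))\<^sup>2)"
      unfolding c_def
      using lborel_integrable_real_affine[OF square_integrableD(3)[OF b], of "-1" 0] by simp
  qed
  from right_averages_AE[OF this]
  have "AE x in distr lborel borel uminus. \<forall>e>0. \<exists>d>0. \<forall>r. 0 < r \<and> r < d \<longrightarrow>
     cmod ((LINT t:{x..x + r}|lborel. c t) - of_real r * c x) \<le> e * r"
    by (simp only: lborel_distr_uminus)
  then have "AE x in lborel. \<forall>e>0. \<exists>d>0. \<forall>r. 0 < r \<and> r < d \<longrightarrow>
     cmod ((LINT t:{- x..- x + r}|lborel. c t) - of_real r * c (- x)) \<le> e * r"
    by (rule AE_distrD[rotated]) simp
  moreover have "(LINT t:{- x..- x + r}|lborel. c t) = (LINT t:{x - r..x}|lborel. b t)" for x r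
  proof -
    have "(LINT t:{x - r..x}|lborel. b t) = \<bar>-1\<bar> *\<^sub>R (\<integral>t. indicator {x - r..x} (0 + (-1) * t) *\<^sub>R b (0 + (-1) * t) \<partial>lborel)"
      unfolding set_lebesgue_integral_def by (rule lborel_integral_real_affine) simp
    also have "\<dots> = (LINT t:{- x..- x + r}|lborel. c t)"
      unfolding set_lebesgue_integral_def
      by (simp add: c_def, rule Bochner_Integration.integral_cong) (auto simp: indicator_def)
    finally show ?thesis by simp
  qed
  ultimately show ?thesis by (simp add: c_def)
qed

lemma symmetric_averages_AE:
  fixes b :: "real \<Rightarrow> complex"
  assumes b: "square_integrable b"
  shows "AE x in lborel. \<forall>e>0. \<exists>d>0. \<forall>r. 0 < r \<and> r < d \<longrightarrow>
     cmod (LINT t:{x - r..x + r}|lborel. b t - b x) \<le> 2 * e * r"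
  using right_averages_AE[OF b] left_averages_AE[OF b]
proof eventually_elim
  case (elim x)
  show ?case
  proof (intro allI impI)
    fix e :: real assume e: "0 < e"
    obtain d1 where d1: "0 < d1" "\<And>r. 0 < r \<Longrightarrow> r < d1 \<Longrightarrow> cmod ((LINT t:{x..x + r}|lborel. b t) - of_real r * b x) \<le> e * r"
      using elim(1)[rule_format, OF e] by metis
    obtain d2 where d2: "0 < d2" "\<And>r. 0 < r \<Longrightarrow> r < d2 \<Longrightarrow> cmod ((LINT t:{x - r..x}|lborel. b t) - of_real r * b x) \<le> e * r"
      using elim(2)[rule_format, OF e] by metis
    show "\<exists>d>0. \<forall>r. 0 < r \<and> r < d \<longrightarrow> cmod (LINT t:{x - r..x + r}|lborel. b t - b x) \<le> 2 * e * r"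
    proof (rule exI[of _ "min d1 d2"], intro conjI allI impI)
      fix r assume r: "0 < r \<and> r < min d1 d2"
      note si = square_integrable_set_integrable[OF b]
      have split: "(LINT t:{x - r..x + r}|lborel. b t) = (LINT t:{x - r..x}|lborel. b t) + (LINT t:{x..x + r}|lborel. b t)"
        unfolding set_borel_integral_eq_integral(2)[OF si]
        by (rule Henstock_Kurzweil_Integration.integral_combine[symmetric])
          (use r set_borel_integral_eq_integral(1)[OF si] in auto)
      have "(LINT t:{x - r..x + r}|lborel. b t - b x) = (LINT t:{x - r..x + r}|lborel. b t) - (LINT t:{x - r..x + r}|lborel. b x)"
        by (rule set_integral_diff(2)[OF si]) (intro borel_integrable_atLeastAtMost' continuous_intros)
      also have "(LINT t:{x - r..x + r}|lborel. b x) = of_real (2 * r) * b x"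
        using r by (simp add: set_integral_const scaleR_conv_of_real)
      finally have "(LINT t:{x - r..x + r}|lborel. b t - b x)
        = ((LINT t:{x - r..x}|lborel. b t) - of_real r * b x) + ((LINT t:{x..x + r}|lborel. b t) - of_real r * b x)"
        unfolding split by (simp add: algebra_simps)
      then show "cmod (LINT t:{x - r..x + r}|lborel. b t - b x) \<le> 2 * e * r"
        using norm_triangle_mono[OF d2(2)[of r] d1(2)[of r]] r by simp
    qed (use d1 d2 in simp)
  qed
qed

text \<open>
  Convergence holds at every point \<open>x\<close> where the symmetric averages of \<open>b - b x\<close> tend to \<open>0\<close>.  Near \<open>x\<close> the
  Poisson integral is controlled by those averages; away from \<open>x\<close> the kernel at height \<open>y\<close> is at most a
  multiple of \<open>y\<close> times the kernel at height \<open>1\<close>.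
\<close>
lemma poisson_integral_vertical_limit:
  fixes b :: "real \<Rightarrow> complex"
  assumes b: "square_integrable b"
  shows "AE x in lborel. ((\<lambda>y. \<integral>t. poisson_kernel y (t - x) * b t \<partial>lborel) \<longlongrightarrow> b x) (at_right 0)"
  using symmetric_averages_AE[OF b]
proof eventually_elim
  case (elim x)
  define e where "e t = b t - b x" for t
  have [measurable]: "b \<in> borel_measurable borel" "e \<in> borel_measurable borel"
    using square_integrableD(2)[OF b] unfolding e_def[abs_def] by auto
  have iPe: "integrable lborel (\<lambda>t. complex_of_real (poisson_kernel y (t - x)) * e t)"
    and Pe: "(\<integral>t. poisson_kernel y (t - x) * b t \<partial>lborel) - b x = (\<integral>t. poisson_kernel y (t - x) * e t \<partial>lborel)"
    if y: "0 < y" for y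
  proof -
    note i1 = square_integrable_mult(1)[OF poisson_kernel_square_integrable[OF y, of x] b]
    have i2: "integrable lborel (\<lambda>t. complex_of_real (poisson_kernel y (t - x)) * b x)"
      using integrable_poisson_kernel[OF y] by (intro integrable_mult_left) auto
    show "integrable lborel (\<lambda>t. complex_of_real (poisson_kernel y (t - x)) * e t)"
      unfolding e_def right_diff_distrib by (rule Bochner_Integration.integrable_diff[OF i1 i2])
    have "(\<integral>t. complex_of_real (poisson_kernel y (t - x)) * b x \<partial>lborel) = b x"
      using integral_poisson_kernel[OF y, of x] by simp
    then show "(\<integral>t. poisson_kernel y (t - x) * b t \<partial>lborel) - b x = (\<integral>t. poisson_kernel y (t - x) * e t \<partial>lborel)"
      unfolding e_def right_diff_distrib Bochner_Integration.integral_diff[OF i1 i2] by simp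
  qed
  define C where "C = (\<integral>t. cmod (poisson_kernel 1 (t - x) * e t) \<partial>lborel)"
  show ?case
  proof (rule tendstoI)
    fix \<epsilon> :: real assume \<epsilon>: "0 < \<epsilon>"
    obtain d where d: "0 < d" "\<And>r. 0 < r \<Longrightarrow> r < d \<Longrightarrow> cmod (LINT t:{x - r..x + r}|lborel. e t) \<le> 2 * (\<epsilon> / 2) * r"
      using elim \<epsilon> unfolding e_def by (meson half_gt_zero)
    define \<delta> where "\<delta> = d / 2"
    have \<delta>: "0 < \<delta>" "\<delta> < d" using d by (simp_all add: \<delta>_def)
    \<comment> \<open>Chosen so that \<open>s\<^sup>2 + 1 \<le> K s\<^sup>2\<close> whenever \<open>\<bar>s\<bar> \<ge> \<delta>\<close>.\<close>
    define K where "K = 1 + 1 / \<delta>\<^sup>2"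
    have K0: "0 < K" using \<delta> by (simp add: K_def add_pos_nonneg)
    have near: "cmod (LINT t:{x - \<delta>..x + \<delta>}|lborel. poisson_kernel y (t - x) * e t) \<le> \<epsilon> / 2" if y: "0 < y" for y
    proof (rule poisson_local_average[OF y \<delta>(1)])
      show "set_integrable lborel {x - \<delta>..x + \<delta>} e"
        unfolding e_def
        by (intro set_integral_diff(1) square_integrable_set_integrable[OF b] borel_integrable_atLeastAtMost' continuous_intros)
    qed (use d \<delta> \<epsilon> in auto)
    have far: "cmod (\<integral>t. indicator (- {x - \<delta>..x + \<delta>}) t *\<^sub>R (poisson_kernel y (t - x) * e t) \<partial>lborel) \<le> y * K * C"
      if y: "0 < y" for y
    proof -
      have pk: "poisson_kernel y s \<le> y * K * poisson_kernel 1 s" if s: "\<delta> \<le> \<bar>s\<bar>" for s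
      proof -
        have s2: "\<delta>\<^sup>2 \<le> s\<^sup>2" using s \<delta> by (metis abs_ge_zero abs_le_square_iff abs_of_pos)
        have s0: "0 < s\<^sup>2" using s \<delta> by auto
        have "1 \<le> s\<^sup>2 / \<delta>\<^sup>2" using s2 \<delta> by (simp add: le_divide_eq)
        moreover have "0 \<le> y\<^sup>2 + y\<^sup>2 / \<delta>\<^sup>2" by simp
        moreover have "K * (s\<^sup>2 + y\<^sup>2) = s\<^sup>2 + s\<^sup>2 / \<delta>\<^sup>2 + (y\<^sup>2 + y\<^sup>2 / \<delta>\<^sup>2)"
          by (simp add: K_def algebra_simps add_divide_distrib)
        ultimately have "s\<^sup>2 + 1 \<le> K * (s\<^sup>2 + y\<^sup>2)" by linarith
        have "poisson_kernel y s = y / pi * (1 / (s\<^sup>2 + y\<^sup>2))" by (simp add: poisson_kernel_def)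
        also have "1 / (s\<^sup>2 + y\<^sup>2) \<le> K / (s\<^sup>2 + 1)"
          using \<open>s\<^sup>2 + 1 \<le> K * (s\<^sup>2 + y\<^sup>2)\<close> s0 by (simp add: divide_simps add_pos_nonneg)
        finally show ?thesis using y by (simp add: poisson_kernel_def field_simps)
      qed
      have "cmod (\<integral>t. indicator (- {x - \<delta>..x + \<delta>}) t *\<^sub>R (poisson_kernel y (t - x) * e t) \<partial>lborel)
         \<le> (\<integral>t. y * K * cmod (poisson_kernel 1 (t - x) * e t) \<partial>lborel)"
      proof (rule Bochner_Integration.integral_norm_bound_integral)
        show "integrable lborel (\<lambda>t. indicator (- {x - \<delta>..x + \<delta>}) t *\<^sub>R (poisson_kernel y (t - x) * e t))"
          by (rule integrable_mult_indicator[OF _ iPe[OF y]]) auto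
        show "integrable lborel (\<lambda>t. y * K * cmod (poisson_kernel 1 (t - x) * e t))"
          by (intro integrable_mult_right integrable_norm iPe) simp
        fix t
        show "norm (indicator (- {x - \<delta>..x + \<delta>}) t *\<^sub>R (poisson_kernel y (t - x) * e t)) \<le> y * K * cmod (poisson_kernel 1 (t - x) * e t)"
        proof (cases "t \<in> {x - \<delta>..x + \<delta>}")
          case False
          then have "\<delta> \<le> \<bar>t - x\<bar>" by auto
          from mult_right_mono[OF pk[OF this], of "cmod (e t)"] show ?thesis
            using False y by (simp add: norm_mult poisson_kernel_nonneg mult.assoc)
        qed (use y K0 in simp)
      qed
      also have "\<dots> = y * K * C" unfolding C_def by (rule integral_mult_right_zero)
      finally show ?thesis .
    qed
    have tot: "cmod ((\<integral>t. poisson_kernel y (t - x) * b t \<partial>lborel) - b x) \<le> \<epsilon> / 2 + y * K * C" if y: "0 < y" for y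
    proof -
      have "(\<integral>t. poisson_kernel y (t - x) * e t \<partial>lborel)
        = (LINT t:{x - \<delta>..x + \<delta>}|lborel. poisson_kernel y (t - x) * e t)
          + (\<integral>t. indicator (- {x - \<delta>..x + \<delta>}) t *\<^sub>R (poisson_kernel y (t - x) * e t) \<partial>lborel)"
        unfolding set_lebesgue_integral_def
        by (subst Bochner_Integration.integral_add[symmetric,
              OF integrable_mult_indicator[OF _ iPe[OF y]] integrable_mult_indicator[OF _ iPe[OF y]]])
          (auto simp: indicator_def intro!: Bochner_Integration.integral_cong)
      then show ?thesis
        unfolding Pe[OF y] using norm_triangle_mono[OF near[OF y] far[OF y]] by simp
    qed
    have "((\<lambda>y. \<epsilon> / 2 + y * K * C) \<longlongrightarrow> \<epsilon> / 2 + 0 * K * C) (at_right 0)"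
      by (intro tendsto_intros)
    then have "\<forall>\<^sub>F y in at_right 0. \<epsilon> / 2 + y * K * C < \<epsilon>"
      by (rule order_tendstoD) (use \<epsilon> in simp)
    moreover have "\<forall>\<^sub>F y :: real in at_right 0. 0 < y" by (simp add: eventually_at_right_less)
    ultimately show "\<forall>\<^sub>F y in at_right 0. dist (\<integral>t. poisson_kernel y (t - x) * b t \<partial>lborel) (b x) < \<epsilon>"
      by eventually_elim (use tot in \<open>fastforce simp: dist_norm\<close>)
  qed
qed

section \<open>Boundary values of Hardy space functions\<close>

lemma bdry_eqI:
  "((\<lambda>y. f (Complex x y)) \<longlongrightarrow> l) (at_right 0) \<Longrightarrow> bdry f x = l"
  unfolding bdry_def by (rule tendsto_Lim) simp_all

text \<open>
  By continuity, the Cauchy criterion for \<open>y \<longlonglongrightarrow> 0\<close> may be tested on rational heights.  The right-hand side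
  involves only countably many conditions, which is what makes the set of such \<open>x\<close> measurable.
\<close>
lemma vertical_limit_exists_iff:
  assumes f: "continuous_on \<complex>\<^sub>+ f"
  shows "(\<exists>l. ((\<lambda>y. f (Complex x y)) \<longlongrightarrow> l) (at_right 0)) \<longleftrightarrow>
    (\<forall>k::nat. \<exists>n::nat. \<forall>p\<in>\<rat>. \<forall>q\<in>\<rat>. 0 < p \<and> p < 1 / Suc n \<and> 0 < q \<and> q < 1 / Suc n \<longrightarrow>
      cmod (f (Complex x p) - f (Complex x q)) \<le> 1 / Suc k)" (is "?L \<longleftrightarrow> ?R")
proof
  assume ?L
  then obtain l where l: "((\<lambda>y. f (Complex x y)) \<longlongrightarrow> l) (at_right 0)" by blast
  show ?R
  proof
    fix k :: nat
    have "\<forall>\<^sub>F y in at_right 0. dist (f (Complex x y)) l < 1 / (2 * Suc k)"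
      by (rule tendstoD[OF l]) simp
    then obtain d where d: "0 < d" "\<And>y. 0 < y \<Longrightarrow> y < d \<Longrightarrow> dist (f (Complex x y)) l < 1 / (2 * Suc k)"
      unfolding eventually_at_right_field by blast
    obtain n where n: "1 / real (Suc n) < d" using d(1) by (metis nat_approx_posE)
    show "\<exists>n::nat. \<forall>p\<in>\<rat>. \<forall>q\<in>\<rat>. 0 < p \<and> p < 1 / Suc n \<and> 0 < q \<and> q < 1 / Suc n \<longrightarrow>
      cmod (f (Complex x p) - f (Complex x q)) \<le> 1 / Suc k"
    proof (intro exI[of _ n] ballI impI)
      fix p q :: real assume "0 < p \<and> p < 1 / Suc n \<and> 0 < q \<and> q < 1 / Suc n"
      then have "dist (f (Complex x p)) l < 1 / (2 * Suc k)" "dist (f (Complex x q)) l < 1 / (2 * Suc k)"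
        using d(2) n by auto
      then have "dist (f (Complex x p)) (f (Complex x q)) < 1 / (2 * Suc k) + 1 / (2 * Suc k)"
        by (rule dist_triangle_less_add)
      also have "\<dots> = 1 / Suc k" by (simp add: field_simps)
      finally show "cmod (f (Complex x p) - f (Complex x q)) \<le> 1 / Suc k" by (simp add: dist_norm)
    qed
  qed
next
  assume R: ?R
  define g where "g y = f (Complex x y)" for y
  have contg: "continuous_on {0<..} g"
    unfolding g_def[abs_def]
    by (rule continuous_on_compose2[OF f]) (auto simp: Complex_eq upper_half_plane_def intro!: continuous_intros)
  have cauchy: "\<exists>n::nat. \<forall>p q. 0 < p \<and> p < 1 / Suc n \<and> 0 < q \<and> q < 1 / Suc n \<longrightarrow> dist (g p) (g q) \<le> 1 / Suc k" for k
  proof -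
    obtain n :: nat where n: "\<And>p q. p \<in> \<rat> \<Longrightarrow> q \<in> \<rat> \<Longrightarrow> 0 < p \<Longrightarrow> p < 1 / Suc n \<Longrightarrow> 0 < q \<Longrightarrow> q < 1 / Suc n \<Longrightarrow>
      cmod (g p - g q) \<le> 1 / Suc k"
      using R[rule_format, of k] unfolding g_def by blast
    let ?I = "{0<..<1 / real (Suc n)}"
    have dense: "?I \<subseteq> closure (?I \<inter> \<rat>)"
    proof
      fix p assume p: "p \<in> ?I"
      show "p \<in> closure (?I \<inter> \<rat>)"
        unfolding closure_approachable
      proof (intro allI impI)
        fix e :: real assume e: "0 < e"
        have "p < min (p + e) (1 / Suc n)" using p e by simp
        then obtain r where r: "r \<in> \<rat>" "p < r" "r < min (p + e) (1 / Suc n)" using Rats_dense_in_real by blast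
        then show "\<exists>y\<in>?I \<inter> \<rat>. dist y p < e"
          by (intro bexI[of _ r]) (use p in \<open>auto simp: dist_real_def\<close>)
      qed
    qed
    have cI: "continuous_on ?I g" by (rule continuous_on_subset[OF contg]) auto
    have seq: "\<exists>r. (\<forall>m. r m \<in> ?I \<inter> \<rat>) \<and> (\<lambda>m. g (r m)) \<longlonglongrightarrow> g p" if p: "p \<in> ?I" for p
    proof -
      obtain r where r: "\<And>m. r m \<in> ?I \<inter> \<rat>" "r \<longlonglongrightarrow> p"
        using subsetD[OF dense p] unfolding closure_sequential by blast
      then have "(\<lambda>m. g (r m)) \<longlonglongrightarrow> g p"
        by (intro continuous_on_tendsto_compose[OF cI r(2) p]) auto
      with r show ?thesis by blast
    qed
    have "dist (g p) (g q) \<le> 1 / Suc k" if pq: "p \<in> ?I" "q \<in> ?I" for p q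
    proof -
      obtain r s where r: "\<And>m. r m \<in> ?I \<inter> \<rat>" "(\<lambda>m. g (r m)) \<longlonglongrightarrow> g p"
        and s: "\<And>m. s m \<in> ?I \<inter> \<rat>" "(\<lambda>m. g (s m)) \<longlonglongrightarrow> g q" using seq pq by meson
      have "(\<lambda>m. dist (g (r m)) (g (s m))) \<longlonglongrightarrow> dist (g p) (g q)"
        by (intro tendsto_intros r s)
      then show ?thesis
        by (rule LIMSEQ_le_const2) (use n r(1) s(1) in \<open>auto simp: dist_norm\<close>)
    qed
    then show ?thesis by (intro exI[of _ n]) auto
  qed
  have "\<exists>l. (g \<longlongrightarrow> l) (at_right 0)"
  proof -
    have "cauchy_filter (filtermap g (at_right 0))"
      unfolding cauchy_filter_metric_filtermap
    proof (intro allI impI)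
      fix e :: real assume e: "0 < e"
      obtain k where k: "1 / real (Suc k) < e" using e by (metis nat_approx_posE)
      obtain n :: nat where n: "\<And>p q. 0 < p \<Longrightarrow> p < 1 / Suc n \<Longrightarrow> 0 < q \<Longrightarrow> q < 1 / Suc n \<Longrightarrow> dist (g p) (g q) \<le> 1 / Suc k"
        using cauchy[of k] by blast
      show "\<exists>P. eventually P (at_right 0) \<and> (\<forall>x y. P x \<and> P y \<longrightarrow> dist (g x) (g y) < e)"
        by (rule exI[of _ "\<lambda>p. 0 < p \<and> p < 1 / Suc n"])
          (use n k in \<open>auto simp: eventually_at_right_field intro!: exI[of _ "1 / real (Suc n)"] intro: order_le_less_trans\<close>)
    qed
    then show ?thesis
      using complete_UNIV unfolding complete_uniform
      by (metis (no_types, lifting) UNIV_I filterlim_def filtermap_bot_iff trivial_limit_at_right_real principal_UNIV top_greatest)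
  qed
  then show ?L unfolding g_def .
qed

text \<open>
  Integrals of \<open>bdry f\<close> carry information only if \<open>bdry f\<close> itself is measurable, including its values at
  points without a limit.
\<close>
lemma bdry_measurable:
  assumes f: "continuous_on \<complex>\<^sub>+ f"
  shows "bdry f \<in> borel_measurable borel"
proof -
  define A where "A = {x. \<exists>l. ((\<lambda>y. f (Complex x y)) \<longlongrightarrow> l) (at_right 0)}"
  have [measurable]: "slice f y \<in> borel_measurable borel" if "0 < y" for y
    by (rule slice_measurable(2)[OF f that])
  have Rats: "(\<forall>p\<in>\<rat>. P p) \<longleftrightarrow> (\<forall>r :: rat. P (of_rat r))" for P :: "real \<Rightarrow> bool"
    by (auto simp: Rats_def)
  have "A = {x \<in> space borel. \<forall>k::nat. \<exists>n::nat. \<forall>p q :: rat.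
      0 < real_of_rat p \<and> real_of_rat p < 1 / Suc n \<and> 0 < real_of_rat q \<and> real_of_rat q < 1 / Suc n \<longrightarrow>
      cmod (slice f (of_rat p) x - slice f (of_rat q) x) \<le> 1 / Suc k}"
    unfolding A_def vertical_limit_exists_iff[OF f] slice_def Rats by simp
  also have "\<dots> \<in> sets borel"
  proof -
    have pq: "{x \<in> space borel. 0 < p \<and> p < 1 / Suc n \<and> 0 < q \<and> q < 1 / Suc n \<longrightarrow>
      cmod (slice f p x - slice f q x) \<le> 1 / Suc k} \<in> sets borel" for p q :: real and n k :: nat
      by (cases "0 < p \<and> 0 < q") (auto, measurable)
    show ?thesis
      by (intro sets.sets_Collect_countable_All sets.sets_Collect_countable_Ex
          pq)
  qed
  finally have A: "A \<in> sets borel" .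
  have lim: "bdry f x = lim (\<lambda>n. slice f (1 / Suc n) x)" if x: "x \<in> A" for x
  proof -
    obtain l where l: "((\<lambda>y. f (Complex x y)) \<longlongrightarrow> l) (at_right 0)" using x by (auto simp: A_def)
    have "filterlim (\<lambda>n. 1 / real (Suc n)) (at_right 0) sequentially" by real_asymp
    from filterlim_compose[OF l this] have "(\<lambda>n. slice f (1 / Suc n) x) \<longlonglongrightarrow> l"
      by (simp add: slice_def)
    then show ?thesis using bdry_eqI[of f, OF l] by (simp add: limI)
  qed
  \<comment> \<open>Without a limit, \<open>Lim\<close> is a definite description of nothing, hence one fixed value for all such \<open>x\<close>.\<close>
  have nolim: "bdry f x = (THE l. False)" if x: "x \<notin> A" for x
    using x unfolding A_def bdry_def Topological_Spaces.Lim_def by simp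
  have "bdry f = (\<lambda>x. if x \<in> A then lim (\<lambda>n. slice f (1 / Suc n) x) else (THE l. False))"
    using lim nolim by (intro ext) simp
  also have "\<dots> \<in> borel_measurable borel"
    by (rule measurable_If_set) (use A in \<open>auto intro!: borel_measurable_lim_metric\<close>)
  finally show ?thesis .
qed

text \<open>
  Fatou's theorem for \<open>H\<^sup>2\<close>: the density of the Poisson representation is almost everywhere the vertical
  limit.
\<close>
lemma hardy2_bdry:
  assumes f: "f \<in> hardy2"
  shows "AE x in lborel. ((\<lambda>y. f (Complex x y)) \<longlongrightarrow> bdry f x) (at_right 0)"
    and "square_integrable (bdry f)"
    and "\<And>x y. 0 < y \<Longrightarrow> f (Complex x y) = (\<integral>t. poisson_kernel y (t - x) * bdry f t \<partial>lborel)"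
proof -
  obtain b :: "real \<Rightarrow> complex" where b: "square_integrable b"
    "\<And>x y. 0 < y \<Longrightarrow> f (Complex x y) = (\<integral>t. poisson_kernel y (t - x) * b t \<partial>lborel)"
    using hardy2_poisson_representation[OF f] by blast
  have lim: "AE x in lborel. ((\<lambda>y. f (Complex x y)) \<longlongrightarrow> b x) (at_right 0)"
    using poisson_integral_vertical_limit[OF b(1)]
  proof eventually_elim
    case (elim x)
    have "\<forall>\<^sub>F y in at_right 0. f (Complex x y) = (\<integral>t. poisson_kernel y (t - x) * b t \<partial>lborel)"
      using eventually_at_right_less[of 0] by eventually_elim (rule b(2))
    then show ?case using elim by (simp add: tendsto_cong)
  qed
  then have eq: "AE x in lborel. bdry f x = b x"
    by eventually_elim (rule bdry_eqI)
  show "AE x in lborel. ((\<lambda>y. f (Complex x y)) \<longlongrightarrow> bdry f x) (at_right 0)"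
    using lim eq by eventually_elim simp
  have [measurable]: "bdry f \<in> borel_measurable borel"
    by (rule bdry_measurable[OF holomorphic_on_imp_continuous_on[OF hardy2_holomorphic[OF f]]])
  show "square_integrable (bdry f)"
    by (rule square_integrable_cong_AE[OF b(1)]) (use eq in auto)
  note [measurable] = square_integrableD(2)[OF b(1)]
  show "f (Complex x y) = (\<integral>t. poisson_kernel y (t - x) * bdry f t \<partial>lborel)" if "0 < y" for x y
    unfolding b(2)[OF that] by (rule integral_cong_AE) (use eq in auto)
qed

section \<open>Cauchy formulas and point evaluations\<close>

lemma conj_pole_vertical_limit:
  assumes w: "w \<in> \<complex>\<^sub>+"
  shows "((\<lambda>y. 1 / (Complex x y - cnj w)) \<longlongrightarrow> 1 / (of_real x - cnj w)) (at_right 0)"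
proof -
  have "((\<lambda>y. 1 / (of_real x + \<i> * of_real y - cnj w)) \<longlongrightarrow> 1 / (of_real x + \<i> * of_real 0 - cnj w)) (at_right 0)"
    by (intro tendsto_intros) (use w in \<open>auto simp: complex_eq_iff upper_half_plane_def\<close>)
  then show ?thesis by (simp add: Complex_eq)
qed

lemma bdry_mult_AE:
  assumes f: "f \<in> hardy2" and g: "AE x in lborel. ((\<lambda>y. g (Complex x y)) \<longlongrightarrow> l x) (at_right 0)"
  shows "AE x in lborel. bdry (\<lambda>z. g z * f z) x = l x * bdry f x"
  using hardy2_bdry(1)[OF f] g by eventually_elim (intro bdry_eqI tendsto_mult)

lemma bdry_diff_AE:
  assumes f: "f \<in> hardy2" and g: "g \<in> hardy2"
  shows "AE x in lborel. bdry (\<lambda>z. f z - g z) x = bdry f x - bdry g x"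
  using hardy2_bdry(1)[OF f] hardy2_bdry(1)[OF g] by eventually_elim (intro bdry_eqI tendsto_diff)

text \<open>
  The product \<open>H z = f z / (z - cnj w)\<close> is in \<open>H\<^sup>2\<close> with integrable boundary values.  Multiply its Poisson
  formula at \<open>\<i>y\<close> by \<open>\<pi> y\<close>: since \<open>\<pi> y P\<^sub>y\<close> increases to \<open>1\<close>, the right side tends to the integral of the
  boundary values, while \<open>\<bar>y H (\<i>y)\<bar> \<le> \<bar>f (\<i>y)\<bar>\<close> tends to \<open>0\<close>.
\<close>
lemma hardy2_integral_pole_below:
  assumes f: "f \<in> hardy2" and w: "w \<in> \<complex>\<^sub>+"
  shows "(\<integral>x. 1 / (of_real x - cnj w) * bdry f x \<partial>lborel) = 0"
proof -
  have v: "0 < Im w" using w by (simp add: upper_half_plane_def)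
  define H where "H z = 1 / (z - cnj w) * f z" for z
  have dist: "y \<le> cmod (Complex x y - cnj w)" "Im w \<le> cmod (Complex x y - cnj w)" if "0 < y" for x y
    using abs_Im_le_cmod[of "Complex x y - cnj w"] that v by auto
  have H: "H \<in> hardy2"
    unfolding H_def[abs_def]
  proof (rule hardy2_mult_bounded[OF f])
    show "(\<lambda>z. 1 / (z - cnj w)) holomorphic_on \<complex>\<^sub>+"
      using conj_pole_in_hardy2[OF w] by (rule hardy2_holomorphic)
    fix z assume "z \<in> \<complex>\<^sub>+"
    then have "Im w \<le> cmod (z - cnj w)"
      using dist(2)[of "Im z" "Re z"] by (simp add: upper_half_plane_def)
    then show "cmod (1 / (z - cnj w)) \<le> 1 / Im w"
      using v by (simp add: norm_divide frac_le)
  qed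
  have bH: "AE x in lborel. bdry H x = 1 / (of_real x - cnj w) * bdry f x"
    unfolding H_def[abs_def] by (rule bdry_mult_AE[OF f]) (use conj_pole_vertical_limit[OF w] in auto)
  note [measurable] = square_integrableD(2)[OF hardy2_bdry(2)[OF f]] square_integrableD(2)[OF hardy2_bdry(2)[OF H]]
  have c: "square_integrable (\<lambda>x. 1 / (complex_of_real x - cnj w))"
    by (rule cauchy_kernel_square_integrable(1)) (use v in simp)
  note [measurable] = square_integrableD(2)[OF c]
  have iH: "integrable lborel (bdry H)"
  proof (rule integrable_cong_AE_imp[OF square_integrable_mult(1)[OF c hardy2_bdry(2)[OF f]]])
    show "AE x in lborel. 1 / (of_real x - cnj w) * bdry f x = bdry H x"
      using bH by eventually_elim simp
  qed simp
  let ?k = "\<lambda>y t. complex_of_real (pi * y * poisson_kernel y (t - 0))"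
  have l0: "(\<lambda>n. \<integral>t. ?k (real (Suc n)) t * bdry H t \<partial>lborel) \<longlonglongrightarrow> (\<integral>t. bdry H t \<partial>lborel)"
  proof (rule integral_dominated_convergence)
    show "integrable lborel (\<lambda>t. cmod (bdry H t))" using iH by (rule integrable_norm)
    have "(\<lambda>n. pi * real (Suc n) * poisson_kernel (real (Suc n)) (t - 0)) \<longlonglongrightarrow> 1" for t
      unfolding poisson_kernel_def by real_asymp
    then have "(\<lambda>n. ?k (real (Suc n)) t * bdry H t) \<longlonglongrightarrow> of_real 1 * bdry H t" for t
      by (intro tendsto_mult tendsto_of_real tendsto_const)
    then show "AE t in lborel. (\<lambda>n. ?k (real (Suc n)) t * bdry H t) \<longlonglongrightarrow> bdry H t"
      by simp
    show "AE t in lborel. norm (?k (real (Suc n)) t * bdry H t) \<le> cmod (bdry H t)" for n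
    proof (rule AE_I2)
      fix t
      have "pi * real (Suc n) * poisson_kernel (real (Suc n)) (t - 0) \<le> pi * real (Suc n) * (1 / (pi * real (Suc n)))"
        by (intro mult_left_mono poisson_kernel_le) auto
      then have "\<bar>pi * real (Suc n) * poisson_kernel (real (Suc n)) (t - 0)\<bar> \<le> 1"
        using poisson_kernel_nonneg[of "real (Suc n)" "t - 0"] by (simp add: abs_mult)
      then show "norm (?k (real (Suc n)) t * bdry H t) \<le> cmod (bdry H t)"
        unfolding norm_mult norm_of_real by (rule mult_left_le_one_le[rotated 2]) auto
    qed
  qed auto
  have scaled: "(\<integral>t. ?k y t * bdry H t \<partial>lborel) = of_real (pi * y) * H (Complex 0 y)" if "0 < y" for y
    unfolding hardy2_bdry(3)[OF H that] integral_mult_right_zero[symmetric]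
    by (simp add: mult.assoc)
  have l1: "(\<lambda>n. of_real (pi * real (Suc n)) * H (Complex 0 (real (Suc n)))) \<longlonglongrightarrow> (\<integral>t. bdry H t \<partial>lborel)"
    using l0 unfolding scaled[OF of_nat_0_less_iff[THEN iffD2, OF zero_less_Suc]] .
  obtain E where E: "0 \<le> E" "\<And>y. 0 < y \<Longrightarrow> square_integrable (slice f y)"
    "\<And>y. 0 < y \<Longrightarrow> norm_L2 (slice f y) \<le> E" using hardy2_slices[OF f] by blast
  have "(\<lambda>n. of_real (pi * real (Suc n)) * H (Complex 0 (real (Suc n)))) \<longlonglongrightarrow> 0"
  proof (rule Lim_null_comparison)
    show "(\<lambda>n. pi * (3 * E / sqrt (real (Suc n)))) \<longlonglongrightarrow> 0" by real_asymp
    show "\<forall>\<^sub>F n in sequentially. norm (of_real (pi * real (Suc n)) * H (Complex 0 (real (Suc n)))) \<le> pi * (3 * E / sqrt (real (Suc n)))"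
    proof (rule always_eventually, rule allI)
      fix n
      let ?y = "real (Suc n)"
      have y: "0 < ?y" by simp
      have "cmod (f (Complex 0 ?y)) \<le> 3 * E / sqrt ?y"
        using hardy2_pointwise_bound[OF hardy2_holomorphic[OF f] E(2,3), of "Complex 0 ?y"] by simp
      moreover have "cmod (H (Complex 0 ?y)) \<le> cmod (f (Complex 0 ?y)) / ?y"
        using dist(1)[OF y, of 0] unfolding H_def norm_mult norm_divide
        by (simp add: frac_le)
      moreover from this have "?y * cmod (H (Complex 0 ?y)) \<le> cmod (f (Complex 0 ?y))"
        using y by (simp add: le_divide_eq mult.commute)
      ultimately have "?y * cmod (H (Complex 0 ?y)) \<le> 3 * E / sqrt ?y" by linarith
      from mult_left_mono[OF this, of pi]
      show "norm (of_real (pi * ?y) * H (Complex 0 ?y)) \<le> pi * (3 * E / sqrt ?y)"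
        unfolding norm_mult norm_of_real by (simp add: abs_mult mult.assoc)
    qed
  qed
  with l1 have "(\<integral>t. bdry H t \<partial>lborel) = 0" by (rule LIMSEQ_unique)
  moreover have "(\<integral>t. bdry H t \<partial>lborel) = (\<integral>x. 1 / (of_real x - cnj w) * bdry f x \<partial>lborel)"
    by (rule integral_cong_AE) (use bH in auto)
  ultimately show ?thesis by simp
qed

lemma hardy2_cauchy_formula:
  assumes f: "f \<in> hardy2" and w: "w \<in> \<complex>\<^sub>+"
  shows "(\<integral>x. 1 / (of_real x - w) * bdry f x \<partial>lborel) = 2 * of_real pi * \<i> * f w"
proof -
  have v: "0 < Im w" using w by (simp add: upper_half_plane_def)
  note b = hardy2_bdry(2)[OF f]
  have i: "integrable lborel (\<lambda>x. 1 / (of_real x - a) * bdry f x)" if "Im a \<noteq> 0" for a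
    by (rule square_integrable_mult(1)[OF cauchy_kernel_square_integrable(1)[OF that] b])
  have "2 * of_real pi * \<i> * f w = 2 * of_real pi * \<i> * (\<integral>t. poisson_kernel (Im w) (t - Re w) * bdry f t \<partial>lborel)"
    using hardy2_bdry(3)[OF f v, of "Re w"] by simp
  also have "\<dots> = (\<integral>t. 2 * of_real pi * \<i> * (poisson_kernel (Im w) (t - Re w) * bdry f t) \<partial>lborel)"
    by (rule integral_mult_right_zero[symmetric])
  also have "\<dots> = (\<integral>t. 1 / (of_real t - w) * bdry f t - 1 / (of_real t - cnj w) * bdry f t \<partial>lborel)"
    unfolding poisson_kernel_eq_cauchy[OF v] by (simp add: left_diff_distrib)
  also have "\<dots> = (\<integral>t. 1 / (of_real t - w) * bdry f t \<partial>lborel) - (\<integral>t. 1 / (of_real t - cnj w) * bdry f t \<partial>lborel)"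
    by (rule Bochner_Integration.integral_diff[OF i i]) (use v in simp_all)
  finally show ?thesis using hardy2_integral_pole_below[OF f w] by simp
qed

text \<open>
  Cauchy-Schwarz in the Cauchy formula gives the constant \<open>1 / (2 sqrt \<pi>)\<close>, here rounded up to \<open>1\<close>.
\<close>
lemma hardy2_point_evaluation:
  assumes f: "f \<in> hardy2" and w: "w \<in> \<complex>\<^sub>+"
  shows "sqrt (Im w) * cmod (f w) \<le> hardy2_norm f"
proof -
  have v: "0 < Im w" using w by (simp add: upper_half_plane_def)
  have "2 * pi * cmod (f w) = cmod (\<integral>x. 1 / (of_real x - w) * bdry f x \<partial>lborel)"
    unfolding hardy2_cauchy_formula[OF f w] by (simp add: norm_mult)
  also have "\<dots> \<le> norm_L2 (\<lambda>x. 1 / (of_real x - w)) * norm_L2 (bdry f)"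
    by (rule square_integrable_mult(3)[OF cauchy_kernel_square_integrable(1) hardy2_bdry(2)[OF f]]) (use v in simp)
  also have "\<dots> = sqrt pi / sqrt (Im w) * hardy2_norm f"
    using v by (subst cauchy_kernel_square_integrable(2)) (auto simp: real_sqrt_divide hardy2_norm_eq)
  finally have "2 * pi * (sqrt (Im w) * cmod (f w)) \<le> sqrt pi * hardy2_norm f"
    using v by (simp add: field_simps)
  also have "\<dots> \<le> (2 * pi) * hardy2_norm f"
  proof (rule mult_right_mono)
    have "sqrt pi \<le> sqrt (pi * pi)" using pi_ge_two by (intro real_sqrt_le_mono) auto
    then have "sqrt pi \<le> pi" by simp
    then show "sqrt pi \<le> 2 * pi" using pi_gt_zero by linarith
  qed (simp add: hardy2_norm_eq norm_L2_nonneg)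
  finally show ?thesis by simp
qed

text \<open>
  Normalised point evaluations tend weakly to \<open>0\<close>.  Truncate the boundary function to \<open>[-R, R]\<close>: the
  truncated part contributes \<open>O(1 / sqrt y)\<close>, since the Cauchy kernel is at most \<open>1 / y\<close>, and the rest
  contributes at most its norm, which is small for large \<open>R\<close>.
\<close>
lemma hardy2_decay_imaginary_axis:
  assumes g: "g \<in> hardy2" and y: "filterlim y at_top F"
  shows "((\<lambda>n. sqrt (y n) * cmod (g (Complex 0 (y n)))) \<longlongrightarrow> 0) F"
proof -
  define b where "b = bdry g"
  have b: "square_integrable b" unfolding b_def by (rule hardy2_bdry(2)[OF g])
  note [measurable] = square_integrableD(2)[OF b]
  define bR where "bR R t = of_real (indicator {- R..R} t) * b t" for R t :: real
  have [measurable]: "bR R \<in> borel_measurable borel" for R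
    unfolding bR_def[abs_def] by measurable
  have bR: "square_integrable (bR R)" for R
    by (rule square_integrable_dominated(1)[OF b, of _ 1]) (auto simp: bR_def indicator_def)
  have ibR: "integrable lborel (bR R)" for R
  proof -
    have "set_integrable lborel {-R..R} b" by (rule square_integrable_set_integrable[OF b])
    then show ?thesis by (simp add: set_integrable_def bR_def[abs_def] scaleR_conv_of_real)
  qed
  have "(\<lambda>n. \<integral>t. (cmod (b t - bR (real n) t))\<^sup>2 \<partial>lborel) \<longlonglongrightarrow> (\<integral>t. 0 \<partial>(lborel :: real measure))"
  proof (rule integral_dominated_convergence)
    show "integrable lborel (\<lambda>t. (cmod (b t))\<^sup>2)" by (rule square_integrableD(3)[OF b])
    show "AE t in lborel. (\<lambda>n. (cmod (b t - bR (real n) t))\<^sup>2) \<longlonglongrightarrow> 0"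
    proof (rule AE_I2)
      fix t :: real
      have "\<forall>\<^sub>F n in sequentially. (cmod (b t - bR (real n) t))\<^sup>2 = 0"
        using eventually_ge_at_top[of "nat \<lceil>\<bar>t\<bar>\<rceil>"]
      proof eventually_elim
        case (elim n)
        then have "\<bar>t\<bar> \<le> real n" by linarith
        then show ?case by (auto simp: bR_def indicator_def abs_le_iff)
      qed
      then show "(\<lambda>n. (cmod (b t - bR (real n) t))\<^sup>2) \<longlonglongrightarrow> 0" by (rule tendsto_eventually)
    qed
  qed (auto simp: bR_def indicator_def)
  then have tail: "(\<lambda>n. norm_L2 (\<lambda>t. b t - bR (real n) t)) \<longlonglongrightarrow> 0"
    unfolding norm_L2_def using tendsto_real_sqrt by fastforce
  have est: "sqrt v * cmod (g (Complex 0 v))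
     \<le> norm_L2 (\<lambda>t. b t - bR R t) + (\<integral>t. cmod (bR R t) \<partial>lborel) / sqrt v" if v: "0 < v" for v R
  proof -
    let ?w = "Complex 0 v"
    let ?c = "\<lambda>t. 1 / (complex_of_real t - ?w)"
    have c: "square_integrable ?c" "norm_L2 ?c = sqrt (pi / v)"
      using cauchy_kernel_square_integrable[of ?w] v by auto
    have d: "square_integrable (\<lambda>t. b t - bR R t)" by (rule norm_L2_diff_expand(1)[OF b bR])
    have cle: "cmod (?c t) \<le> 1 / v" for t
      using abs_Im_le_cmod[of "complex_of_real t - ?w"] v by (simp add: norm_divide frac_le)
    have "2 * of_real pi * \<i> * g ?w = (\<integral>t. ?c t * b t \<partial>lborel)"
      using hardy2_cauchy_formula[OF g, of ?w] v by (simp add: b_def)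
    also have "\<dots> = (\<integral>t. ?c t * (b t - bR R t) + ?c t * bR R t \<partial>lborel)"
      by (simp add: right_diff_distrib)
    also have "\<dots> = (\<integral>t. ?c t * (b t - bR R t) \<partial>lborel) + (\<integral>t. ?c t * bR R t \<partial>lborel)"
      by (rule Bochner_Integration.integral_add[OF square_integrable_mult(1)[OF c(1) d] square_integrable_mult(1)[OF c(1) bR]])
    also have "cmod \<dots> \<le> sqrt (pi / v) * norm_L2 (\<lambda>t. b t - bR R t) + 1 / v * (\<integral>t. cmod (bR R t) \<partial>lborel)"
    proof (rule norm_triangle_mono)
      show "cmod (\<integral>t. ?c t * (b t - bR R t) \<partial>lborel) \<le> sqrt (pi / v) * norm_L2 (\<lambda>t. b t - bR R t)"
        using square_integrable_mult(3)[OF c(1) d] unfolding c(2) .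
      have "cmod (\<integral>t. ?c t * bR R t \<partial>lborel) \<le> (\<integral>t. 1 / v * cmod (bR R t) \<partial>lborel)"
      proof (rule Bochner_Integration.integral_norm_bound_integral)
        show "integrable lborel (\<lambda>t. ?c t * bR R t)" by (rule square_integrable_mult(1)[OF c(1) bR])
        show "integrable lborel (\<lambda>t. 1 / v * cmod (bR R t))"
          by (intro integrable_mult_right integrable_norm ibR)
        show "norm (?c t * bR R t) \<le> 1 / v * cmod (bR R t)" for t
          unfolding norm_mult by (rule mult_right_mono[OF cle]) simp
      qed
      also have "\<dots> = 1 / v * (\<integral>t. cmod (bR R t) \<partial>lborel)" by (rule integral_mult_right_zero)
      finally show "cmod (\<integral>t. ?c t * bR R t \<partial>lborel) \<le> 1 / v * (\<integral>t. cmod (bR R t) \<partial>lborel)" .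
    qed
    finally have "2 * pi * cmod (g ?w) \<le> sqrt (pi / v) * norm_L2 (\<lambda>t. b t - bR R t) + 1 / v * (\<integral>t. cmod (bR R t) \<partial>lborel)"
      by (simp add: norm_mult)
    from mult_left_mono[OF this, of "sqrt v"]
    have "2 * pi * (sqrt v * cmod (g ?w)) \<le> sqrt v * sqrt (pi / v) * norm_L2 (\<lambda>t. b t - bR R t) + (sqrt v / v) * (\<integral>t. cmod (bR R t) \<partial>lborel)"
      using v by (simp add: algebra_simps)
    also have "sqrt v * sqrt (pi / v) = sqrt pi" using v by (simp add: real_sqrt_divide)
    also have "sqrt v / v = 1 / sqrt v" using v by (simp add: field_simps)
    also have "sqrt pi * norm_L2 (\<lambda>t. b t - bR R t) + 1 / sqrt v * (\<integral>t. cmod (bR R t) \<partial>lborel)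
      \<le> 2 * pi * norm_L2 (\<lambda>t. b t - bR R t) + 2 * pi * (1 / sqrt v * (\<integral>t. cmod (bR R t) \<partial>lborel))"
    proof (rule add_mono)
      have "sqrt pi \<le> sqrt (pi * pi)" using pi_ge_two by (intro real_sqrt_le_mono) auto
      then have "sqrt pi \<le> pi" by simp
      then have "sqrt pi \<le> 2 * pi" using pi_gt_zero by linarith
      then show "sqrt pi * norm_L2 (\<lambda>t. b t - bR R t) \<le> 2 * pi * norm_L2 (\<lambda>t. b t - bR R t)"
        by (rule mult_right_mono) (rule norm_L2_nonneg)
      have "1 * (1 / sqrt v * (\<integral>t. cmod (bR R t) \<partial>lborel)) \<le> 2 * pi * (1 / sqrt v * (\<integral>t. cmod (bR R t) \<partial>lborel))"
        by (rule mult_right_mono) (use pi_ge_two v in auto)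
      then show "1 / sqrt v * (\<integral>t. cmod (bR R t) \<partial>lborel) \<le> 2 * pi * (1 / sqrt v * (\<integral>t. cmod (bR R t) \<partial>lborel))" by simp
    qed
    finally have "2 * pi * (sqrt v * cmod (g ?w)) \<le> 2 * pi * (norm_L2 (\<lambda>t. b t - bR R t) + (\<integral>t. cmod (bR R t) \<partial>lborel) / sqrt v)"
      by (simp add: distrib_left)
    then show ?thesis by simp
  qed
  show ?thesis
  proof (rule tendstoI)
    fix e :: real assume e: "0 < e"
    obtain n where n: "norm_L2 (\<lambda>t. b t - bR (real n) t) < e / 2"
      using order_tendstoD(2)[OF tail, of "e / 2"] e unfolding eventually_sequentially by auto
    let ?I = "\<integral>t. cmod (bR (real n) t) \<partial>lborel"
    have "((\<lambda>v. I / sqrt v) \<longlongrightarrow> 0) at_top" for I :: real by real_asymp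
    from filterlim_compose[OF this y, of ?I] have "\<forall>\<^sub>F k in F. ?I / sqrt (y k) < e / 2"
      by (rule order_tendstoD) (use e in simp)
    moreover have "\<forall>\<^sub>F k in F. 0 < y k" using y unfolding filterlim_at_top_dense by blast
    ultimately show "\<forall>\<^sub>F k in F. dist (sqrt (y k) * cmod (g (Complex 0 (y k)))) 0 < e"
    proof eventually_elim
      case (elim k)
      have "sqrt (y k) * cmod (g (Complex 0 (y k))) < e"
        using est[OF elim(2), of "real n"] elim(1) n by linarith
      then show ?case using elim(2) by (simp add: abs_mult)
    qed
  qed
qed

section \<open>Kernels of the model space\<close>

lemma inner_functionD:
  assumes "inner_function \<Theta>"
  shows "\<Theta> holomorphic_on \<complex>\<^sub>+" "\<And>z. z \<in> \<complex>\<^sub>+ \<Longrightarrow> cmod (\<Theta> z) \<le> 1"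
    "AE x in lborel. ((\<lambda>y. \<Theta> (Complex x y)) \<longlongrightarrow> bdry \<Theta> x) (at_right 0) \<and> cmod (bdry \<Theta> x) = 1"
proof -
  show "\<Theta> holomorphic_on \<complex>\<^sub>+" "\<And>z. z \<in> \<complex>\<^sub>+ \<Longrightarrow> cmod (\<Theta> z) \<le> 1"
    using assms by (auto simp: inner_function_def)
  have "AE x in lborel. \<exists>l. ((\<lambda>y. \<Theta> (Complex x y)) \<longlongrightarrow> l) (at_right 0) \<and> cmod l = 1"
    using assms by (simp add: inner_function_def)
  then show "AE x in lborel. ((\<lambda>y. \<Theta> (Complex x y)) \<longlongrightarrow> bdry \<Theta> x) (at_right 0) \<and> cmod (bdry \<Theta> x) = 1"
  proof eventually_elim
    case (elim x)
    then obtain l where l: "((\<lambda>y. \<Theta> (Complex x y)) \<longlongrightarrow> l) (at_right 0)" "cmod l = 1" by blast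
    then show ?case using bdry_eqI[OF l(1)] by simp
  qed
qed

text \<open>
  A multiple of the reproducing kernel of the model space at \<open>w\<close>; that kernel itself is the case
  \<open>c = \<i> / (2 \<pi>)\<close>.
\<close>
definition model_kernel :: "(complex \<Rightarrow> complex) \<Rightarrow> complex \<Rightarrow> complex \<Rightarrow> complex \<Rightarrow> complex" where
  "model_kernel \<Theta> c w z = c * (1 - cnj (\<Theta> w) * \<Theta> z) * (1 / (z - cnj w))"

text \<open>
  Since \<open>\<bar>\<Theta>\<bar> = 1\<close> on the boundary, the kernel times the conjugate of \<open>\<Theta> g\<close> is the conjugate of
  \<open>(\<Theta> - \<Theta> w) g / (x - w)\<close>, up to the factor \<open>c\<close>.  Its integral vanishes by the Cauchy formula, because
  \<open>(\<Theta> - \<Theta> w) g\<close> is in \<open>H\<^sup>2\<close> and has a zero at \<open>w\<close>.  The norm bound comes from \<open>\<bar>1 - cnj (\<Theta> w) \<Theta>\<bar> \<le> 2\<close> and the norm of the Cauchy kernel.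
\<close>
lemma
  assumes \<Theta>: "inner_function \<Theta>" and w: "w \<in> \<complex>\<^sub>+"
  shows model_kernel_in_model_space: "model_kernel \<Theta> c w \<in> model_space \<Theta>"
    and model_kernel_norm_le: "hardy2_norm (model_kernel \<Theta> c w) \<le> 2 * cmod c * sqrt (pi / Im w)"
proof -
  note T = inner_functionD[OF \<Theta>]
  have v: "0 < Im w" using w by (simp add: upper_half_plane_def)
  let ?r = "\<lambda>z. 1 / (z - cnj w)"
  let ?q = "\<lambda>z. c * (1 - cnj (\<Theta> w) * \<Theta> z)"
  have r: "?r \<in> hardy2" by (rule conj_pole_in_hardy2[OF w])
  have le2: "cmod (c * (1 - cnj (\<Theta> w) * u)) \<le> 2 * cmod c" if "cmod u \<le> 1" for u
  proof -
    have "cmod (cnj (\<Theta> w) * u) \<le> 1 * 1"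
      unfolding norm_mult by (rule mult_mono) (use T(2)[OF w] that in auto)
    then have "cmod (1 - cnj (\<Theta> w) * u) \<le> 2"
      using norm_triangle_ineq4[of 1 "cnj (\<Theta> w) * u"] by simp
    from mult_left_mono[OF this, of "cmod c"] show ?thesis by (simp add: norm_mult mult.commute)
  qed
  have hq: "?q holomorphic_on \<complex>\<^sub>+" by (intro holomorphic_intros T(1))
  have keq: "model_kernel \<Theta> c w = (\<lambda>z. ?q z * ?r z)" by (simp add: model_kernel_def fun_eq_iff)
  have k: "model_kernel \<Theta> c w \<in> hardy2"
    unfolding keq by (rule hardy2_mult_bounded[OF r hq, of "2 * cmod c"]) (use le2 T(2) in blast)
  have br: "bdry ?r x = 1 / (of_real x - cnj w)" for x
    by (rule bdry_eqI[OF conj_pole_vertical_limit[OF w]])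
  have bk: "AE x in lborel. bdry (model_kernel \<Theta> c w) x = c * (1 - cnj (\<Theta> w) * bdry \<Theta> x) * (1 / (of_real x - cnj w))"
  proof -
    have "AE x in lborel. ((\<lambda>y. ?q (Complex x y)) \<longlongrightarrow> c * (1 - cnj (\<Theta> w) * bdry \<Theta> x)) (at_right 0)"
      using T(3) by eventually_elim (intro tendsto_intros, blast)
    from bdry_mult_AE[OF r this] show ?thesis unfolding keq br .
  qed
  have pole: "square_integrable (\<lambda>x. 1 / (of_real x - cnj w))"
    "norm_L2 (\<lambda>x. 1 / (of_real x - cnj w)) = sqrt (pi / Im w)"
    using cauchy_kernel_square_integrable[of "cnj w"] v by auto
  have "norm_L2 (bdry (model_kernel \<Theta> c w)) \<le> 2 * cmod c * norm_L2 (\<lambda>x. 1 / (of_real x - cnj w))"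
  proof (rule square_integrable_dominated(2)[OF pole(1) square_integrableD(1)[OF hardy2_bdry(2)[OF k]]])
    show "AE x in lborel. cmod (bdry (model_kernel \<Theta> c w) x) \<le> 2 * cmod c * cmod (1 / (of_real x - cnj w))"
      using bk T(3)
    proof eventually_elim
      case (elim x)
      have "cmod (c * (1 - cnj (\<Theta> w) * bdry \<Theta> x)) \<le> 2 * cmod c" by (rule le2) (use elim in simp)
      then show ?case unfolding elim(1) norm_mult[of "c * (1 - cnj (\<Theta> w) * bdry \<Theta> x)"]
        by (rule mult_right_mono) simp
    qed
  qed simp
  then show "hardy2_norm (model_kernel \<Theta> c w) \<le> 2 * cmod c * sqrt (pi / Im w)"
    unfolding hardy2_norm_eq pole(2) .
  show "model_kernel \<Theta> c w \<in> model_space \<Theta>"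
    unfolding model_space_def
  proof (intro CollectI conjI ballI k)
    fix g assume g: "g \<in> hardy2"
    define P where "P z = \<Theta> z * g z" for z
    define Q where "Q z = \<Theta> w * g z" for z
    have P: "P \<in> hardy2" unfolding P_def[abs_def] by (rule hardy2_mult_bounded[OF g T(1,2)])
    have Q: "Q \<in> hardy2" unfolding Q_def[abs_def] by (rule hardy2_mult_bounded[OF g _ order_refl]) (intro holomorphic_intros)
    have G: "(\<lambda>z. P z - Q z) \<in> hardy2" by (rule hardy2_diff[OF P Q])
    have bP: "AE x in lborel. bdry P x = bdry \<Theta> x * bdry g x"
      unfolding P_def[abs_def] by (rule bdry_mult_AE[OF g]) (use T(3) in eventually_elim, blast)
    have bQ: "AE x in lborel. bdry Q x = \<Theta> w * bdry g x"
      unfolding Q_def[abs_def] by (rule bdry_mult_AE[OF g]) simp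
    note [measurable] = square_integrableD(2)[OF hardy2_bdry(2)[OF P]] square_integrableD(2)[OF hardy2_bdry(2)[OF k]]
      square_integrableD(2)[OF hardy2_bdry(2)[OF G]]
    have "hardy2_inner (model_kernel \<Theta> c w) P
      = (\<integral>x. c * cnj (1 / (of_real x - w) * bdry (\<lambda>z. P z - Q z) x) \<partial>lborel)"
      unfolding hardy2_inner_def
    proof (rule integral_cong_AE)
      show "AE x in lborel. bdry (model_kernel \<Theta> c w) x * cnj (bdry P x) = c * cnj (1 / (of_real x - w) * bdry (\<lambda>z. P z - Q z) x)"
        using bk bP bQ T(3) bdry_diff_AE[OF P Q]
      proof eventually_elim
        case (elim x)
        have one: "bdry \<Theta> x * cnj (bdry \<Theta> x) = 1"
          using elim(4) by (simp add: complex_norm_square[symmetric])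
        have "bdry (model_kernel \<Theta> c w) x * cnj (bdry P x)
          = c * (cnj (bdry \<Theta> x) - cnj (\<Theta> w) * (bdry \<Theta> x * cnj (bdry \<Theta> x))) * cnj (bdry g x) * (1 / (of_real x - cnj w))"
          unfolding elim(1,2) by (simp add: algebra_simps)
        also have "\<dots> = c * cnj (1 / (of_real x - w) * bdry (\<lambda>z. P z - Q z) x)"
          unfolding one elim(5) elim(2) elim(3) by (simp add: algebra_simps diff_divide_distrib)
        finally show ?case .
      qed
    next
      show "(\<lambda>x. bdry (model_kernel \<Theta> c w) x * cnj (bdry P x)) \<in> borel_measurable lborel"
        using square_integrable_mult(1)[OF hardy2_bdry(2)[OF k] square_integrable_cnj(1)[OF hardy2_bdry(2)[OF P]]]
        by (rule borel_measurable_integrable)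
      have "square_integrable (\<lambda>x. 1 / (of_real x - w))"
        using cauchy_kernel_square_integrable(1)[of w] v by simp
      then have "integrable lborel (\<lambda>x. 1 / (of_real x - w) * bdry (\<lambda>z. P z - Q z) x)"
        by (rule square_integrable_mult(1)) (rule hardy2_bdry(2)[OF G])
      then have "integrable lborel (\<lambda>x. c * cnj (1 / (of_real x - w) * bdry (\<lambda>z. P z - Q z) x))"
        by (intro integrable_mult_right integrable_cnj)
      then show "(\<lambda>x. c * cnj (1 / (of_real x - w) * bdry (\<lambda>z. P z - Q z) x)) \<in> borel_measurable lborel"
        by (rule borel_measurable_integrable)
    qed
    also have "\<dots> = c * cnj (\<integral>x. 1 / (of_real x - w) * bdry (\<lambda>z. P z - Q z) x \<partial>lborel)"
      unfolding integral_mult_right_zero Bochner_Integration.integral_cnj ..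
    also have "\<dots> = 0"
      unfolding hardy2_cauchy_formula[OF G w] by (simp add: P_def Q_def)
    finally show "hardy2_inner (model_kernel \<Theta> c w) (\<lambda>z. \<Theta> z * g z) = 0"
      by (simp add: P_def[abs_def])
  qed
qed

section \<open>Growth of self-maps along the imaginary axis\<close>

text \<open>
  The Schwarz lemma, applied to \<open>\<phi>\<close> conjugated by Cayley transforms to a self-map of the disc that fixes
  \<open>0\<close>.  The point \<open>\<i>y\<close> corresponds to \<open>r = (y - 1) / (y + 1)\<close>, and the resulting bound
  \<open>\<bar>u - a\<bar> \<le> r \<bar>u - cnj a\<bar>\<close> for \<open>u = \<phi> (\<i>y)\<close> and \<open>a = \<phi> \<i>\<close> restricts the imaginary part of \<open>u\<close>.
\<close>
lemma schwarz_pick_imaginary_axis: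
  assumes hol: "\<phi> holomorphic_on \<complex>\<^sub>+" and self: "\<phi> ` \<complex>\<^sub>+ \<subseteq> \<complex>\<^sub>+" and y: "1 \<le> y"
  shows "Im (\<phi> (Complex 0 y)) \<le> y * Im (\<phi> \<i>)"
proof -
  define a where "a = \<phi> \<i>"
  have ii: "\<i> \<in> \<complex>\<^sub>+" by (simp add: upper_half_plane_def)
  have self': "0 < Im (\<phi> z)" if "z \<in> \<complex>\<^sub>+" for z
    using subsetD[OF self imageI[OF that]] by (simp add: upper_half_plane_def)
  have a: "0 < Im a" unfolding a_def by (rule self'[OF ii])
  define C where "C \<zeta> = \<i> * (1 + \<zeta>) / (1 - \<zeta>)" for \<zeta>
  define \<psi> where "\<psi> \<zeta> = (\<phi> (C \<zeta>) - a) / (\<phi> (C \<zeta>) - cnj a)" for \<zeta>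
  have ne1: "1 - \<zeta> \<noteq> 0" if "\<zeta> \<in> ball 0 1" for \<zeta> :: complex
    using that by auto
  have C: "C \<zeta> \<in> \<complex>\<^sub>+" if \<zeta>: "\<zeta> \<in> ball 0 1" for \<zeta>
  proof -
    have "Im (C \<zeta>) = (1 - (cmod \<zeta>)\<^sup>2) / (cmod (1 - \<zeta>))\<^sup>2"
      unfolding C_def by (simp add: Im_divide cmod_power2) (simp add: power2_eq_square algebra_simps)
    moreover have "(cmod \<zeta>)\<^sup>2 < 1" using \<zeta> by (simp add: power_less_one_iff abs_square_less_1)
    ultimately show ?thesis using ne1[OF \<zeta>] by (simp add: upper_half_plane_def)
  qed
  have ph: "0 < Im (\<phi> (C \<zeta>))" if "\<zeta> \<in> ball 0 1" for \<zeta>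
    by (rule self'[OF C[OF that]])
  have holC: "C holomorphic_on ball 0 1"
    unfolding C_def by (intro holomorphic_intros) (use ne1 in auto)
  have holp: "(\<lambda>\<zeta>. \<phi> (C \<zeta>)) holomorphic_on ball 0 1"
    using holomorphic_on_compose_gen[OF holC hol] C by (auto simp: o_def image_subset_iff)
  have hol\<psi>: "\<psi> holomorphic_on ball 0 1"
    unfolding \<psi>_def
  proof (intro holomorphic_intros holp)
    fix \<zeta> :: complex assume "\<zeta> \<in> ball 0 1"
    then show "\<phi> (C \<zeta>) - cnj a \<noteq> 0" using ph[of \<zeta>] a by (auto simp: complex_eq_iff)
  qed
  have lt: "cmod (u - a) < cmod (u - cnj a)" if "0 < Im u" for u
  proof -
    have "(cmod (u - cnj a))\<^sup>2 - (cmod (u - a))\<^sup>2 = 4 * Im u * Im a"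
      unfolding cmod_power2 by (simp add: power2_eq_square algebra_simps)
    moreover have "0 < 4 * Im u * Im a" using that a by simp
    ultimately have "(cmod (u - a))\<^sup>2 < (cmod (u - cnj a))\<^sup>2" by linarith
    then show ?thesis by (rule power2_less_imp_less) simp
  qed
  have \<psi>1: "cmod (\<psi> \<zeta>) < 1" if "cmod \<zeta> < 1" for \<zeta>
  proof -
    have "cmod (\<phi> (C \<zeta>) - a) < cmod (\<phi> (C \<zeta>) - cnj a)"
      by (rule lt[OF ph]) (use that in simp)
    then show ?thesis unfolding \<psi>_def norm_divide by (subst divide_less_eq_1_pos) (auto intro: le_less_trans[OF norm_ge_zero])
  qed
  have "\<psi> 0 = 0" by (simp add: \<psi>_def C_def a_def)
  define r where "r = (y - 1) / (y + 1)"
  have r: "0 \<le> r" "r < 1" using y by (simp_all add: r_def)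
  have Cr: "C (of_real r) = Complex 0 y"
  proof -
    have "(1 + r) / (1 - r) = y" using y by (simp add: r_def field_simps)
    moreover have "C (of_real r) = \<i> * of_real ((1 + r) / (1 - r))" by (simp add: C_def)
    ultimately show ?thesis by (simp add: Complex_eq)
  qed
  have "cmod (\<psi> (of_real r)) \<le> cmod (of_real r)"
    by (rule Schwarz_Lemma(1)[OF hol\<psi> \<open>\<psi> 0 = 0\<close> \<psi>1]) (use r in auto)
  define u where "u = \<phi> (Complex 0 y)"
  have u: "0 < Im u" using ph[of "of_real r"] r by (simp add: Cr u_def)
  have nz: "0 < cmod (u - cnj a)" using lt[OF u] norm_ge_zero[of "u - a"] by linarith
  have "cmod (u - a) / cmod (u - cnj a) \<le> r"
    using \<open>cmod (\<psi> (of_real r)) \<le> cmod (of_real r)\<close> r unfolding \<psi>_def Cr u_def[symmetric] norm_divide by simp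
  then have "cmod (u - a) \<le> r * cmod (u - cnj a)" using nz by (simp add: divide_le_eq)
  then have "(cmod (u - a))\<^sup>2 \<le> (r * cmod (u - cnj a))\<^sup>2" by (rule power_mono) simp
  then have "(Re u - Re a)\<^sup>2 + (Im u - Im a)\<^sup>2 \<le> r\<^sup>2 * ((Re u - Re a)\<^sup>2 + (Im u + Im a)\<^sup>2)"
    unfolding power_mult_distrib cmod_power2 by simp
  moreover have "r\<^sup>2 * (Re u - Re a)\<^sup>2 \<le> 1 * (Re u - Re a)\<^sup>2"
    using r by (intro mult_right_mono) (auto simp: power_le_one)
  ultimately have "(Im u - Im a)\<^sup>2 \<le> (r * (Im u + Im a))\<^sup>2"
    unfolding power_mult_distrib distrib_left[of "r\<^sup>2" "(Re u - Re a)\<^sup>2"] by linarith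
  then have "Im u - Im a \<le> r * (Im u + Im a)"
    by (rule power2_le_imp_le) (use r u a in simp)
  then have "(y + 1) * (Im u - Im a) \<le> (y - 1) * (Im u + Im a)"
    using y unfolding r_def by (simp add: field_simps)
  then have "Im u \<le> y * Im a" by (simp add: algebra_simps)
  then show ?thesis by (simp add: u_def a_def)
qed

section \<open>Non-compactness\<close>

theorem theorem3p3:
  fixes \<Theta> \<phi> :: "complex \<Rightarrow> complex"
  assumes "inner_function \<Theta>"
    and "\<not> \<Theta> constant_on \<complex>\<^sub>+"
    and "\<phi> holomorphic_on \<complex>\<^sub>+"
    and "\<phi> ` \<complex>\<^sub>+ \<subseteq> \<complex>\<^sub>+"
    and "(SUP z\<in>\<complex>\<^sub>+. cmod (\<Theta> (\<phi> z))) < 1"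
    and "bounded_into_hardy2 (model_space \<Theta>) (comp_op \<phi>)"
  shows "\<not> compact_into_hardy2 (model_space \<Theta>) (comp_op \<phi>)"
proof
  assume compact: "compact_into_hardy2 (model_space \<Theta>) (comp_op \<phi>)"
  have T: "cmod (\<Theta> z) \<le> 1" if "z \<in> \<complex>\<^sub>+" for z
    using inner_functionD(2)[OF assms(1) that] .
  have \<phi>: "\<phi> z \<in> \<complex>\<^sub>+" if "z \<in> \<complex>\<^sub>+" for z using assms(4) that by blast
  have ii: "\<i> \<in> \<complex>\<^sub>+" by (simp add: upper_half_plane_def)
  define s where "s = (SUP z\<in>\<complex>\<^sub>+. cmod (\<Theta> (\<phi> z)))"
  have s: "cmod (\<Theta> (\<phi> z)) \<le> s" if "z \<in> \<complex>\<^sub>+" for z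
    unfolding s_def using that T \<phi> by (intro cSUP_upper bdd_aboveI2[of _ _ 1]) auto
  have s01: "0 \<le> s" "s < 1"
    using order_trans[OF norm_ge_zero s[OF ii]] assms(5) by (simp_all add: s_def)
  define a where "a = Im (\<phi> \<i>)"
  have a: "0 < a" using \<phi>[OF ii] by (simp add: a_def upper_half_plane_def)
  define w where "w n = \<phi> (Complex 0 (real (Suc n)))" for n
  have w: "w n \<in> \<complex>\<^sub>+" "0 < Im (w n)" for n
    using \<phi>[of "Complex 0 (real (Suc n))"] by (auto simp: w_def upper_half_plane_def)
  have wle: "Im (w n) \<le> real (Suc n) * a" for n
    unfolding w_def a_def by (rule schwarz_pick_imaginary_axis[OF assms(3,4)]) simp
  define f where "f n = model_kernel \<Theta> (of_real (sqrt (Im (w n)))) (w n)" for n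
  define c where "c = (1 - s\<^sup>2) / (2 * sqrt a)"
  have c: "0 < c" using s01 a by (simp add: c_def power_less_one_iff)
  have fM: "f n \<in> model_space \<Theta>" for n
    unfolding f_def by (rule model_kernel_in_model_space[OF assms(1) w(1)])
  have "hardy2_norm (f n) \<le> 2 * sqrt pi" for n
  proof -
    have "hardy2_norm (f n) \<le> 2 * cmod (of_real (sqrt (Im (w n)))) * sqrt (pi / Im (w n))"
      unfolding f_def by (rule model_kernel_norm_le[OF assms(1) w(1)])
    also have "\<dots> = 2 * sqrt pi" using w(2)[of n] by (simp add: real_sqrt_divide)
    finally show ?thesis .
  qed
  with fM compact obtain g r where g: "g \<in> hardy2" and r: "strict_mono r"
    and lim: "(\<lambda>n. hardy2_norm (\<lambda>z. comp_op \<phi> (f (r n)) z - g z)) \<longlonglongrightarrow> 0"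
    unfolding compact_into_hardy2_def by blast
  define Y where "Y n = real (Suc (r n))" for n
  have Ypos: "0 < Y n" for n by (simp add: Y_def)
  have Ylim: "filterlim Y at_top sequentially"
    unfolding Y_def by (rule filterlim_compose[OF filterlim_real_sequentially])
      (rule filterlim_compose[OF filterlim_Suc filterlim_subseq[OF r]])
  \<comment> \<open>The value at \<open>w\<close> is of order \<open>1 / sqrt (Im w)\<close>, and \<open>Im (w n) \<le> (n + 1) a\<close> makes the factor
      \<open>sqrt (n + 1)\<close> outweigh it.\<close>
  have low: "c \<le> sqrt (real (Suc n)) * cmod (f n (w n))" for n
  proof -
    let ?v = "Im (w n)"
    have "cmod (\<Theta> (w n)) \<le> s" unfolding w_def by (rule s) simp
    then have sq: "(cmod (\<Theta> (w n)))\<^sup>2 \<le> s\<^sup>2" by (rule power_mono) simp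
    have s2: "s\<^sup>2 < 1" using s01 by (simp add: power_less_one_iff)
    have "1 - cnj (\<Theta> (w n)) * \<Theta> (w n) = complex_of_real (1 - (cmod (\<Theta> (w n)))\<^sup>2)"
      unfolding of_real_diff of_real_1 complex_norm_square by (simp add: mult.commute)
    moreover have "w n - cnj (w n) = \<i> * of_real (2 * ?v)" by (simp add: complex_eq_iff)
    ultimately have "cmod (f n (w n)) = sqrt ?v * (1 - (cmod (\<Theta> (w n)))\<^sup>2) / (2 * ?v)"
      unfolding f_def model_kernel_def using w(2)[of n] sq s2
      by (simp only: norm_mult norm_divide norm_of_real) (simp add: abs_of_nonneg)
    also have "\<dots> = (1 - (cmod (\<Theta> (w n)))\<^sup>2) / (2 * sqrt ?v)"
      using w(2)[of n] by (simp add: field_simps)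
    finally have val: "cmod (f n (w n)) = (1 - (cmod (\<Theta> (w n)))\<^sup>2) / (2 * sqrt ?v)" .
    have "c = sqrt (real (Suc n)) * ((1 - s\<^sup>2) / (2 * sqrt (real (Suc n) * a)))"
      by (simp add: c_def real_sqrt_mult)
    also have "\<dots> \<le> sqrt (real (Suc n)) * ((1 - (cmod (\<Theta> (w n)))\<^sup>2) / (2 * sqrt ?v))"
      using sq s2 w(2)[of n] wle[of n] by (intro mult_left_mono frac_le) auto
    finally show ?thesis by (simp only: val)
  qed
  have "c \<le> hardy2_norm (\<lambda>z. comp_op \<phi> (f (r n)) z - g z) + sqrt (Y n) * cmod (g (Complex 0 (Y n)))" for n
  proof -
    let ?h = "\<lambda>z. comp_op \<phi> (f (r n)) z - g z"
    have "comp_op \<phi> (f (r n)) \<in> hardy2"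
      using assms(6) fM by (auto simp: bounded_into_hardy2_def)
    then have h: "?h \<in> hardy2" by (rule hardy2_diff[OF _ g])
    have "c \<le> sqrt (Y n) * cmod (comp_op \<phi> (f (r n)) (Complex 0 (Y n)))"
      using low[of "r n"] by (simp add: comp_op_def w_def Y_def)
    also have "cmod (comp_op \<phi> (f (r n)) (Complex 0 (Y n))) \<le> cmod (?h (Complex 0 (Y n))) + cmod (g (Complex 0 (Y n)))"
      using norm_triangle_ineq[of "?h (Complex 0 (Y n))" "g (Complex 0 (Y n))"] by simp
    finally have "c \<le> sqrt (Y n) * cmod (?h (Complex 0 (Y n))) + sqrt (Y n) * cmod (g (Complex 0 (Y n)))"
      using Ypos[of n] by (simp add: distrib_left)
    then show ?thesis using hardy2_point_evaluation[OF h, of "Complex 0 (Y n)"] Ypos[of n] by simp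
  qed
  moreover have "(\<lambda>n. hardy2_norm (\<lambda>z. comp_op \<phi> (f (r n)) z - g z) + sqrt (Y n) * cmod (g (Complex 0 (Y n)))) \<longlonglongrightarrow> 0 + 0"
    by (intro tendsto_add lim hardy2_decay_imaginary_axis g Ylim)
  ultimately have "c \<le> 0 + 0" by (intro LIMSEQ_le_const) auto
  with c show False by simp
qed

end
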